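(* Let $k \ge 10$ be an even integer and let $\alpha$ be real with $\alpha \ge 3-\frac{k}{2}$ and $|\alpha| \ge 1$. Then $$\int_{-\eta}^{\eta} (1-x^2)^\alpha \left(\mathbf{P}_k^{(\alpha,\alpha)}(x)\right)^2 dx > 1 - \frac{5}{3(1-q)^{1/3}u^{1/6}} > 1 - \frac53\left(\frac{k+\alpha}{(k+2\alpha)k}\right)^{1/3},$$ where $$\eta = \sqrt{1-q}\left(1 - \frac{4\cdot 2^{1/3}}{3(1-q)^{2/3}u^{1/3}}\right).$$
   Context: $u=(k+\alpha)(k+\alpha+1)$ and $q=(\alpha^2-1)/u$. $P_k^{(\alpha,\alpha)}$ is the ultraspherical polynomial, i.e. the Jacobi polynomial $P_k^{(\alpha,\beta)}$ with $\beta=\alpha$ in the standard normalization, $P_k^{(\alpha,\beta)}(x) = 2^{-k}\sum_{j=0}^k \binom{k+\alpha}{j}\binom{k+\beta}{k-j}(x-1)^{k-j}(x+1)^j$, where $\binom{a}{j} = a(a-1)\cdots(a-j+1)/j!$ for real $a$. The orthonormal polynomial is $\mathbf{P}_k^{(\alpha,\alpha)} = P_k^{(\alpha,\alpha)}/\sqrt{L}$ with $$L=\frac{2^{2\alpha+1}\,\Gamma^2(k+\alpha+1)}{(2k+2\alpha+1)\,\Gamma(k+2\alpha+1)\,k!}.$$ For $\alpha>-1$ this is $L=\int_{-1}^1(1-x^2)^\alpha (P_k^{(\alpha,\alpha)}(x))^2dx$; for $\alpha\le -1$ (with $\alpha>-\frac{k+1}{2}$) the normalization is defined by the same formula for $L$,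 which is positive. *)

theory Defs
  imports "HOL-Analysis.Analysis"
begin

definition jacobi_P :: "nat \<Rightarrow> real \<Rightarrow> real \<Rightarrow> real \<Rightarrow> real" where
  "jacobi_P k \<alpha> \<beta> x =
     (1 / 2 ^ k) *
     (\<Sum>j=0..k. ((real k + \<alpha>) gchoose j) * ((real k + \<beta>) gchoose (k - j))
                 * (x - 1) ^ (k - j) * (x + 1) ^ j)"

text \<open>For \<open>\<alpha> > -1\<close> this closed form is the integral of
  \<open>(1 - x\<^sup>2) powr \<alpha> * (jacobi_P k \<alpha> \<alpha> x)\<^sup>2\<close> over \<open>[-1, 1]\<close>;
  for \<open>-(k + 1) / 2 < \<alpha> \<le> -1\<close> the (positive) closed form itself is taken as the normalization.\<close>

definition ultraspherical_norm_sq :: "nat \<Rightarrow> real \<Rightarrow> real" where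
  "ultraspherical_norm_sq k \<alpha> =
     2 powr (2 * \<alpha> + 1) * (Gamma (real k + \<alpha> + 1))\<^sup>2 /
     ((2 * real k + 2 * \<alpha> + 1) * Gamma (real k + 2 * \<alpha> + 1) * fact k)"

definition orthonormal_ultraspherical :: "nat \<Rightarrow> real \<Rightarrow> real \<Rightarrow> real" where
  "orthonormal_ultraspherical k \<alpha> x =
     jacobi_P k \<alpha> \<alpha> x / sqrt (ultraspherical_norm_sq k \<alpha>)"

definition param_u :: "nat \<Rightarrow> real \<Rightarrow> real" where
  "param_u k \<alpha> = (real k + \<alpha>) * (real k + \<alpha> + 1)"

definition param_q :: "nat \<Rightarrow> real \<Rightarrow> real" where
  "param_q k \<alpha> = (\<alpha>\<^sup>2 - 1) / param_u k \<alpha>"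

text \<open>For \<open>k \<ge> 10\<close>, \<open>\<alpha> \<ge> 3 - k / 2\<close> and \<open>\<bar>\<alpha>\<bar> \<ge> 1\<close> one has \<open>param_u k \<alpha> > 0\<close> and
  \<open>0 \<le> param_q k \<alpha> < 1\<close>, so every \<open>powr\<close> with a fractional exponent has a positive base.\<close>

definition cutoff_eta :: "nat \<Rightarrow> real \<Rightarrow> real" where
  "cutoff_eta k \<alpha> =
     sqrt (1 - param_q k \<alpha>) *
     (1 - 4 * 2 powr (1/3) /
          (3 * (1 - param_q k \<alpha>) powr (2/3) * param_u k \<alpha> powr (1/3)))"

end

theory Submission
  imports Defs "HOL-Real_Asymp.Real_Asymp"
begin

text \<open>
  Put \<open>y x = (1 - x\<^sup>2) powr ((\<alpha> + 1) / 2) * p x\<close> with \<open>p\<close> the normalised polynomial.  Then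
  \<open>y'' + Q y = 0\<close> with \<open>Q = u (1 - q - x\<^sup>2) / (1 - x\<^sup>2)\<^sup>2\<close>, and the integrand is \<open>y\<^sup>2 / (1 - x\<^sup>2)\<close>.
  For every smooth \<open>c\<close> the quadratic form
  \<open>F = c y'\<^sup>2 - c' y y' + (c Q + c'' / 2) y\<^sup>2\<close> has the derivative
  \<open>(2 c' Q + c Q' + c''' / 2) y\<^sup>2\<close>.  Hence, if \<open>2 c' Q + c Q' + c''' / 2 \<le> 1 / (1 - x\<^sup>2)\<close> on
  \<open>[0, b]\<close> and \<open>F\<close> is positive semidefinite at \<open>b\<close>, the integral over \<open>[0, b]\<close> is at least \<open>- F 0\<close>,
  whatever the phase and the amplitude of \<open>y\<close> at \<open>b\<close> are.  For even \<open>k\<close> one has \<open>y' 0 = 0\<close>, so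
  \<open>F 0\<close> is a multiple of \<open>(y 0)\<^sup>2\<close>, which is an explicit quotient of Gamma values.

  Write \<open>D = 1 - q\<close>, \<open>x = sqrt D * t\<close>, \<open>t = cos \<theta>\<close> and \<open>r = D powr (- 1/3) * u powr (- 1/6)\<close>; the error
  term of the theorem is \<open>5/3 * r\<close>, and always \<open>r \<le> 1/2\<close>.  Up to a constant, the
  semiclassical choice of \<open>c\<close> is \<open>- (1 - x\<^sup>2) * (\<theta> - \<kappa>) / sin \<theta>\<close>: for every constant \<open>\<kappa>\<close> it makes
  \<open>2 c' Q + c Q'\<close> exactly \<open>1 / (1 - x\<^sup>2)\<close>.  The function \<open>\<theta> / sin \<theta>\<close> is smooth even at the turning
  point \<open>\<theta> = 0\<close>, so its share of \<open>c'''\<close> costs only a factor \<open>1 - r ^ 6\<close>.  The share of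
  \<open>\<kappa> / sin \<theta>\<close> is singular there and has the wrong sign; a multiple of \<open>1 / sin \<theta> ^ 7\<close> absorbs it
  (lemma \<open>comparison_inequality\<close>).  Semidefiniteness at the end point needs \<open>\<kappa>\<close> to exceed the
  final angle.  That angle is taken as \<open>48/25 * r\<close>, just inside the cutoff, and \<open>\<kappa> = 49/20 * r\<close>
  suffices (lemma \<open>comparison_boundary\<close>).

  To leading order the bound is \<open>(pi / 2 - \<kappa>) * sqrt D * (p 0)\<^sup>2\<close>.  Two applications of
  \<open>(Gamma (z + 1/2) / Gamma (z + 1))\<^sup>2 \<ge> 1 / (z + 1/3)\<close> give
  \<open>sqrt D * (p 0)\<^sup>2 \<ge> 2 / pi * (1 - r ^ 3 / 6)\<close>.  So the loss is \<open>2 / pi * \<kappa> < 1.56 * r\<close> plus terms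
  of order \<open>r ^ 3\<close> and \<open>r ^ 6\<close>, which fit below \<open>5/3 * r\<close> because \<open>r \<le> 1/2\<close>.
\<close>

section \<open>The differential equation and the central value of the polynomials\<close>

text \<open>
  Applied to a product \<open>X ^ i * Y ^ j\<close> of powers of \<open>x - 1\<close> and \<open>x + 1\<close>, the differential
  operator stays homogeneous of degree \<open>i + j\<close>, since \<open>1 - x\<^sup>2 = - X * Y\<close> and \<open>2 * x = X + Y\<close>; it
  only mixes neighbouring exponents.
\<close>

lemma binomial_product_derivative_operator:
  fixes x \<alpha> :: real and i j :: nat
  defines "X \<equiv> x - 1" and "Y \<equiv> x + 1"
  shows "(1 - x\<^sup>2) * (real i * real (i - 1) * X ^ (i - 2) * Y ^ j
            + 2 * real i * real j * X ^ (i - 1) * Y ^ (j - 1)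
            + real j * real (j - 1) * X ^ i * Y ^ (j - 2))
         - 2 * (\<alpha> + 1) * x * (real i * X ^ (i - 1) * Y ^ j + real j * X ^ i * Y ^ (j - 1))
         = - (real i * (real i + \<alpha>)) * X ^ (i - 1) * Y ^ (j + 1)
           - (real j * (real j + \<alpha>)) * X ^ (i + 1) * Y ^ (j - 1)
           - (2 * real i * real j + (\<alpha> + 1) * (real i + real j)) * X ^ i * Y ^ j"
proof -
  have xx: "1 - x\<^sup>2 = - X * Y" "2 * x = X + Y"
    by (auto simp: X_def Y_def power2_eq_square algebra_simps)
  have e1: "X * (real i * X ^ (i - 1)) = real i * X ^ i" for i by (cases i) auto
  have e2: "Y * (real j * Y ^ (j - 1)) = real j * Y ^ j" for j by (cases j) auto
  have e3: "X * (real i * real (i - 1) * X ^ (i - 2)) = real i * (real i - 1) * X ^ (i - 1)"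
  proof (cases i)
    case (Suc n) then show ?thesis by (cases n) auto
  qed auto
  have e4: "Y * (real j * real (j - 1) * Y ^ (j - 2)) = real j * (real j - 1) * Y ^ (j - 1)"
  proof (cases j)
    case (Suc n) then show ?thesis by (cases n) auto
  qed auto
  let ?Xi = "X ^ i" and ?Yj = "Y ^ j"
  have "(1 - x\<^sup>2) * (real i * real (i - 1) * X ^ (i - 2) * Y ^ j
            + 2 * real i * real j * X ^ (i - 1) * Y ^ (j - 1)
            + real j * real (j - 1) * X ^ i * Y ^ (j - 2))
      = - (X * (real i * real (i - 1) * X ^ (i - 2))) * (Y * Y ^ j)
        - 2 * (X * (real i * X ^ (i - 1))) * (Y * (real j * Y ^ (j - 1)))
        - (X * X ^ i) * (Y * (real j * real (j - 1) * Y ^ (j - 2)))"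
    unfolding xx by (simp add: algebra_simps)
  also have "\<dots> = - (real i * (real i - 1) * X ^ (i - 1)) * (Y * Y ^ j)
        - 2 * (real i * X ^ i) * (real j * Y ^ j)
        - (X * X ^ i) * (real j * (real j - 1) * Y ^ (j - 1))"
    unfolding e1 e2 e3 e4 ..
  finally have second: "(1 - x\<^sup>2) * (real i * real (i - 1) * X ^ (i - 2) * Y ^ j
            + 2 * real i * real j * X ^ (i - 1) * Y ^ (j - 1)
            + real j * real (j - 1) * X ^ i * Y ^ (j - 2)) = \<dots>" .
  have "2 * (\<alpha> + 1) * x * (real i * X ^ (i - 1) * Y ^ j + real j * X ^ i * Y ^ (j - 1))
      = (\<alpha> + 1) * (2 * x) * (real i * X ^ (i - 1) * Y ^ j + real j * X ^ i * Y ^ (j - 1))"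
    by simp
  also have "\<dots> = (\<alpha> + 1) * (X * (real i * X ^ (i - 1)) * Y ^ j + X ^ i * (Y * (real j * Y ^ (j - 1)))
        + real i * X ^ (i - 1) * (Y * Y ^ j) + (X * X ^ i) * (real j * Y ^ (j - 1)))"
    unfolding xx by (simp add: algebra_simps)
  also have "\<dots> = (\<alpha> + 1) * ((real i * X ^ i) * Y ^ j + X ^ i * (real j * Y ^ j)
        + real i * X ^ (i - 1) * (Y * Y ^ j) + (X * X ^ i) * (real j * Y ^ (j - 1)))"
    unfolding e1 e2 ..
  finally show ?thesis unfolding second by (simp add: algebra_simps)
qed

lemma ultraspherical_coefficient_recurrence:
  fixes \<alpha> :: real and k j :: nat
  defines "a \<equiv> \<lambda>j. ((real k + \<alpha>) gchoose j) * ((real k + \<alpha>) gchoose (k - j))"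
  assumes "j < k"
  shows "real (j + 1) * (real (j + 1) + \<alpha>) * a (j + 1)
       = (real k + \<alpha> - real j) * (real (k - j)) * a j"
proof -
  obtain i where k: "k = j + Suc i" using assms(2) less_iff_Suc_add by auto
  let ?s = "real k + \<alpha>"
  have 1: "real (Suc j) * (?s gchoose Suc j) = (?s - real j) * (?s gchoose j)"
    by (simp add: gbinomial_absorption gbinomial_mult_1 algebra_simps)
  have 2: "real (Suc i) * (?s gchoose Suc i) = (?s - real i) * (?s gchoose i)"
    by (simp add: gbinomial_absorption gbinomial_mult_1 algebra_simps)
  have e: "real (j + 1) + \<alpha> = ?s - real i" using k by simp
  have d: "k - j = Suc i" "k - (j + 1) = i" using k by auto
  have "real (j + 1) * (real (j + 1) + \<alpha>) * a (j + 1)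
     = (real (Suc j) * (?s gchoose Suc j)) * ((?s - real i) * (?s gchoose i))"
    unfolding a_def e d by (simp add: algebra_simps)
  also have "\<dots> = (?s - real j) * (?s gchoose j) * (real (Suc i) * (?s gchoose Suc i))"
    unfolding 1 2 ..
  finally show ?thesis unfolding a_def d by (simp add: algebra_simps)
qed

text \<open>
  The operator maps each summand to a combination of itself and its two neighbours; by the
  coefficient recurrence the contributions of neighbours cancel.
\<close>

lemma jacobi_P_differential_equation:
  fixes \<alpha> :: real and k :: nat
  shows "\<exists>P' P''. (\<forall>x. (jacobi_P k \<alpha> \<alpha> has_real_derivative P' x) (at x))
     \<and> (\<forall>x. (P' has_real_derivative P'' x) (at x))
     \<and> (\<forall>x. (1 - x\<^sup>2) * P'' x - 2 * (\<alpha> + 1) * x * P' x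
            + real k * (real k + 2 * \<alpha> + 1) * jacobi_P k \<alpha> \<alpha> x = 0)"
proof -
  define a where "a = (\<lambda>j. ((real k + \<alpha>) gchoose j) * ((real k + \<alpha>) gchoose (k - j)))"
  define m0 where "m0 = (\<lambda>i j (x::real). (x - 1) ^ i * (x + 1) ^ j)"
  define m1 where "m1 = (\<lambda>i j (x::real). real i * (x - 1) ^ (i - 1) * (x + 1) ^ j
        + real j * (x - 1) ^ i * (x + 1) ^ (j - 1))"
  define m2 where "m2 = (\<lambda>i j (x::real). real i * real (i - 1) * (x - 1) ^ (i - 2) * (x + 1) ^ j
            + 2 * real i * real j * (x - 1) ^ (i - 1) * (x + 1) ^ (j - 1)
            + real j * real (j - 1) * (x - 1) ^ i * (x + 1) ^ (j - 2))"
  have d0: "(m0 i j has_real_derivative m1 i j x) (at x)" for i j x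
    unfolding m0_def m1_def by (auto intro!: derivative_eq_intros)
  have d1: "(m1 i j has_real_derivative m2 i j x) (at x)" for i j x
    unfolding m1_def m2_def
    by (auto intro!: derivative_eq_intros simp: algebra_simps numeral_2_eq_2)
  have P: "jacobi_P k \<alpha> \<alpha> = (\<lambda>x. 1 / 2 ^ k * (\<Sum>j\<le>k. a j * m0 (k - j) j x))"
    unfolding jacobi_P_def a_def m0_def by (auto simp: fun_eq_iff atLeast0AtMost mult.assoc)
  define P' where "P' = (\<lambda>x. 1 / 2 ^ k * (\<Sum>j\<le>k. a j * m1 (k - j) j x))"
  define P'' where "P'' = (\<lambda>x. 1 / 2 ^ k * (\<Sum>j\<le>k. a j * m2 (k - j) j x))"
  have "(jacobi_P k \<alpha> \<alpha> has_real_derivative P' x) (at x)" for x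
    unfolding P P'_def by (intro DERIV_cmult DERIV_sum d0)
  moreover have "(P' has_real_derivative P'' x) (at x)" for x
    unfolding P'_def P''_def by (intro DERIV_cmult DERIV_sum d1)
  moreover have "(1 - x\<^sup>2) * P'' x - 2 * (\<alpha> + 1) * x * P' x
            + real k * (real k + 2 * \<alpha> + 1) * jacobi_P k \<alpha> \<alpha> x = 0" for x
  proof -
    define s where "s = real k + \<alpha>"
    define U where "U = (\<lambda>j. real j * (real j + \<alpha>) * a j * m0 (k - j) j x)"
    define V where "V = (\<lambda>j. (s - real j) * real (k - j) * a j * m0 (k - j) j x)"
    have term0: "a j * ((1 - x\<^sup>2) * m2 (k - j) j x - 2 * (\<alpha> + 1) * x * m1 (k - j) j x
              + real k * (real k + 2 * \<alpha> + 1) * m0 (k - j) j x)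
       = (U j - (if j < k then U (Suc j) else 0)) + (V j - (if j > 0 then V (j - 1) else 0))"
      if jk: "j \<le> k" for j
    proof -
      let ?i = "k - j"
      have ri: "real ?i = real k - real j" using jk by simp
      have up: "real ?i * (real ?i + \<alpha>) * a j * ((x - 1) ^ (?i - 1) * (x + 1) ^ (j + 1))
            = (if j < k then U (Suc j) else 0)"
      proof (cases "j < k")
        case True
        have "(s - real j) * real ?i * a j = real (j + 1) * (real (j + 1) + \<alpha>) * a (j + 1)"
          unfolding a_def s_def by (rule ultraspherical_coefficient_recurrence[OF True, symmetric])
        moreover have "s - real j = real ?i + \<alpha>" unfolding s_def ri by simp
        ultimately have "real ?i * (real ?i + \<alpha>) * a j
            = real (Suc j) * (real (Suc j) + \<alpha>) * a (Suc j)"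
          by (simp only: mult.commute Suc_eq_plus1)
        moreover have "?i - 1 = k - Suc j" by simp
        ultimately show ?thesis using True by (simp only: U_def m0_def if_True Suc_eq_plus1)
      qed (use jk in auto)
      have down: "real j * (real j + \<alpha>) * a j * ((x - 1) ^ (?i + 1) * (x + 1) ^ (j - 1))
            = (if j > 0 then V (j - 1) else 0)"
      proof (cases "j > 0")
        case True
        have jm: "j - 1 < k" "j - 1 + 1 = j" using True jk by auto
        have "real j * (real j + \<alpha>) * a j = (s - real (j - 1)) * real (k - (j - 1)) * a (j - 1)"
          using ultraspherical_coefficient_recurrence[OF jm(1), of \<alpha>] jm(2)
          unfolding a_def s_def by simp
        moreover have "k - (j - 1) = ?i + 1" using True jk by simp
        ultimately show ?thesis using True by (simp only: V_def m0_def if_True)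
      qed auto
      have op: "(1 - x\<^sup>2) * m2 ?i j x - 2 * (\<alpha> + 1) * x * m1 ?i j x
           + real k * (real k + 2 * \<alpha> + 1) * m0 ?i j x =
           - (real ?i * (real ?i + \<alpha>)) * (x - 1) ^ (?i - 1) * (x + 1) ^ (j + 1)
           - (real j * (real j + \<alpha>)) * (x - 1) ^ (?i + 1) * (x + 1) ^ (j - 1)
           - (2 * real ?i * real j + (\<alpha> + 1) * (real ?i + real j)) * m0 ?i j x
           + real k * (real k + 2 * \<alpha> + 1) * m0 ?i j x"
        using binomial_product_derivative_operator[of x ?i j \<alpha>]
        unfolding m0_def m1_def m2_def by simp
      have "a j * ((1 - x\<^sup>2) * m2 ?i j x - 2 * (\<alpha> + 1) * x * m1 ?i j x
           + real k * (real k + 2 * \<alpha> + 1) * m0 ?i j x) = U j + V j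
         - real ?i * (real ?i + \<alpha>) * a j * ((x - 1) ^ (?i - 1) * (x + 1) ^ (j + 1))
         - real j * (real j + \<alpha>) * a j * ((x - 1) ^ (?i + 1) * (x + 1) ^ (j - 1))"
        unfolding op U_def V_def s_def ri by (simp add: algebra_simps)
      then have "a j * ((1 - x\<^sup>2) * m2 ?i j x - 2 * (\<alpha> + 1) * x * m1 ?i j x
           + real k * (real k + 2 * \<alpha> + 1) * m0 ?i j x)
           = U j + V j - (if j < k then U (Suc j) else 0) - (if j > 0 then V (j - 1) else 0)"
        unfolding up down .
      moreover have "u + v - b - c = (u - b) + (v - c)" for u v b c :: real by simp
      ultimately show ?thesis by (rule trans)
    qed
    have "(1 - x\<^sup>2) * P'' x - 2 * (\<alpha> + 1) * x * P' x
            + real k * (real k + 2 * \<alpha> + 1) * jacobi_P k \<alpha> \<alpha> x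
        = 1 / 2 ^ k * (\<Sum>j\<le>k. a j * ((1 - x\<^sup>2) * m2 (k - j) j x
             - 2 * (\<alpha> + 1) * x * m1 (k - j) j x
             + real k * (real k + 2 * \<alpha> + 1) * m0 (k - j) j x))"
    proof -
      have lin: "(\<Sum>j\<le>k. a j * (A * m2 (k - j) j x - B * m1 (k - j) j x + C * m0 (k - j) j x))
          = A * (\<Sum>j\<le>k. a j * m2 (k - j) j x) - B * (\<Sum>j\<le>k. a j * m1 (k - j) j x)
            + C * (\<Sum>j\<le>k. a j * m0 (k - j) j x)" for A B C :: real
        by (simp add: sum_distrib_left sum.distrib sum_subtractf distrib_left right_diff_distrib
              mult.left_commute)
      have "A * (c * S2) - B * (c * S1) + C * (c * S0) = c * (A * S2 - B * S1 + C * S0)"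
        for A B C c S0 S1 S2 :: real by (simp add: algebra_simps)
      then show ?thesis unfolding P P'_def P''_def lin .
    qed
    also have "(\<Sum>j\<le>k. a j * ((1 - x\<^sup>2) * m2 (k - j) j x - 2 * (\<alpha> + 1) * x * m1 (k - j) j x
             + real k * (real k + 2 * \<alpha> + 1) * m0 (k - j) j x))
        = (\<Sum>j\<le>k. (U j - (if j < k then U (Suc j) else 0))
                + (V j - (if j > 0 then V (j - 1) else 0)))"
      by (intro sum.cong refl term0) auto
    also have "\<dots> = (\<Sum>j\<le>k. U j) - (\<Sum>j<k. U (Suc j))
        + ((\<Sum>j\<le>k. V j) - (\<Sum>j<k. V j))"
    proof -
      have "(\<Sum>j\<le>k. if j < k then U (Suc j) else 0) = (\<Sum>j<k. U (Suc j))"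
        by (rule sum.mono_neutral_cong_right) auto
      moreover have "(\<Sum>j\<le>k. if j > 0 then V (j - 1) else 0) = (\<Sum>j<k. V j)"
        by (simp add: sum.atMost_shift)
      ultimately show ?thesis by (simp add: sum.distrib sum_subtractf)
    qed
    also have "\<dots> = U 0 + V k"
    proof -
      have "(\<Sum>j\<le>k. U j) = U 0 + (\<Sum>j<k. U (Suc j))" by (rule sum.atMost_shift)
      moreover have "(\<Sum>j\<le>k. V j) = (\<Sum>j<k. V j) + V k"
        by (simp flip: lessThan_Suc_atMost)
      ultimately show ?thesis by simp
    qed
    also have "\<dots> = 0" by (simp add: U_def V_def)
    finally show ?thesis by simp
  qed
  ultimately show ?thesis by blast
qed

text \<open>
  The reflection \<open>x \<mapsto> - x\<close> exchanges the roles of \<open>j\<close> and \<open>k - j\<close>.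
\<close>

lemma jacobi_P_even:
  assumes "even k"
  shows "jacobi_P k \<alpha> \<alpha> (- x) = jacobi_P k \<alpha> \<alpha> x"
proof -
  let ?t = "\<lambda>j. ((real k + \<alpha>) gchoose j) * ((real k + \<alpha>) gchoose (k - j))
                 * (x - 1) ^ (k - j) * (x + 1) ^ j"
  have "(\<Sum>j=0..k. ((real k + \<alpha>) gchoose j) * ((real k + \<alpha>) gchoose (k - j))
                 * (- x - 1) ^ (k - j) * (- x + 1) ^ j) = (\<Sum>j=0..k. ?t (k - j))"
  proof (rule sum.cong[OF refl])
    fix j assume j: "j \<in> {0..k}"
    have "(- x - 1) ^ (k - j) * (- x + 1) ^ j = (- (x + 1)) ^ (k - j) * (- (x - 1)) ^ j" by simp
    also have "\<dots> = ((-1) ^ (k - j) * (-1) ^ j) * ((x + 1) ^ (k - j) * (x - 1) ^ j)"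
      unfolding power_minus[of "x + 1"] power_minus[of "x - 1"] by (simp add: mult_ac)
    also have "(-1 :: real) ^ (k - j) * (-1) ^ j = 1"
      using j assms by (simp flip: power_add)
    finally show "((real k + \<alpha>) gchoose j) * ((real k + \<alpha>) gchoose (k - j))
                 * (- x - 1) ^ (k - j) * (- x + 1) ^ j = ?t (k - j)"
      using j by (simp add: mult_ac)
  qed
  also have "\<dots> = (\<Sum>j=0..k. ?t j)" using sum.atLeastAtMost_rev[of ?t 0 k] by simp
  finally show ?thesis unfolding jacobi_P_def by simp
qed

text \<open>At the origin the defining sum is the \<open>k\<close>-th coefficient of
  \<open>(1 + z) powr s * (1 - z) powr s = (1 - z\<^sup>2) powr s\<close> with \<open>s = k + \<alpha>\<close>.\<close>

lemma alternating_binomial_convolution: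
  fixes s :: real
  shows "(\<Sum>j=0..2*m. (s gchoose j) * ((-1) ^ (2*m - j) * (s gchoose (2*m - j))))
         = (-1) ^ m * (s gchoose m)"
proof -
  define B where "B = fps_binomial s"
  define B' where "B' = Abs_fps (\<lambda>n. (-1) ^ n * (s gchoose n))"
  have Bd: "(1 + fps_X) * fps_deriv B = fps_const s * B"
    unfolding B_def fps_binomial_deriv by (simp add: fps_divide_unit inverse_mult_eq_1' mult.left_commute[of "1 + fps_X"])
  have nth_rec: "real (Suc n) * (s gchoose Suc n) = (s - real n) * (s gchoose n)" for n
    by (simp add: gbinomial_absorption gbinomial_mult_1 algebra_simps)
  have B'd: "(1 - fps_X) * fps_deriv B' = - fps_const s * B'"
  proof (rule fps_ext)
    fix n
    show "fps_nth ((1 - fps_X) * fps_deriv B') n = fps_nth (- fps_const s * B') n"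
    proof -
      have "fps_nth ((1 - fps_X) * fps_deriv B') n
          = real (Suc n) * fps_nth B' (Suc n) - real n * fps_nth B' n"
        by (cases n) (simp_all add: left_diff_distrib)
      also have "\<dots> = - ((-1) ^ n * (real (Suc n) * (s gchoose Suc n)) + (-1) ^ n * (real n * (s gchoose n)))"
        unfolding B'_def by (simp add: mult_ac)
      also have "\<dots> = - s * ((-1) ^ n * (s gchoose n))"
        unfolding nth_rec by (simp add: algebra_simps)
      finally show ?thesis by (simp add: B'_def flip: fps_const_neg)
    qed
  qed
  define H where "H = B * B'"
  have "(1 - fps_X\<^sup>2) * fps_deriv H
      = (1 - fps_X) * B' * ((1 + fps_X) * fps_deriv B) + (1 + fps_X) * B * ((1 - fps_X) * fps_deriv B')"
    unfolding H_def by (simp add: power2_eq_square algebra_simps)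
  also have "\<dots> = fps_const (- 2 * s) * (fps_X * H)"
    unfolding Bd B'd H_def
    by (simp add: algebra_simps numeral_fps_const flip: fps_const_mult fps_const_neg)
  finally have Hd: "(1 - fps_X\<^sup>2) * fps_deriv H = fps_const (- 2 * s) * (fps_X * H)" .
  have rec: "real (n + 2) * fps_nth H (n + 2) = (real n - 2 * s) * fps_nth H n" for n
  proof -
    have "fps_nth (fps_deriv H - fps_X\<^sup>2 * fps_deriv H) (n + 1) = - 2 * s * fps_nth H n"
      using arg_cong[OF Hd, of "\<lambda>f. fps_nth f (n + 1)"] by (simp add: left_diff_distrib)
    moreover have "fps_nth (fps_X\<^sup>2 * fps_deriv H) (n + 1) = real n * fps_nth H n"
      by (cases n) (simp_all add: fps_X_power_mult_nth)
    ultimately show ?thesis by (simp add: algebra_simps)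
  qed
  have "fps_nth H (2 * m) = (-1) ^ m * (s gchoose m)"
  proof (induction m)
    case 0 then show ?case by (simp add: H_def B_def B'_def)
  next
    case (Suc m)
    have "2 * (real (Suc m) * fps_nth H (2 * Suc m)) = 2 * ((real m - s) * ((-1) ^ m * (s gchoose m)))"
      using rec[of "2 * m"] Suc by (simp add: algebra_simps)
    also have "\<dots> = 2 * ((-1) ^ Suc m * (real (Suc m) * (s gchoose Suc m)))"
      unfolding nth_rec by (simp add: algebra_simps)
    finally have "real (Suc m) * fps_nth H (2 * Suc m) = real (Suc m) * ((-1) ^ Suc m * (s gchoose Suc m))"
      by (simp add: mult_ac)
    then show ?case using mult_left_cancel[of "real (Suc m)"] by (metis of_nat_0_eq_iff nat.distinct(1))
  qed
  then show ?thesis unfolding H_def B_def B'_def fps_mult_nth by simp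
qed

lemma jacobi_P_at_zero:
  fixes \<alpha> :: real
  assumes "k = 2 * m"
  shows "(jacobi_P k \<alpha> \<alpha> 0)\<^sup>2 = ((real k + \<alpha>) gchoose m)\<^sup>2 / 4 ^ k"
proof -
  have "jacobi_P k \<alpha> \<alpha> 0 = 1 / 2 ^ k * ((-1) ^ m * ((real k + \<alpha>) gchoose m))"
    using alternating_binomial_convolution[where m = m and s = "real k + \<alpha>"] assms
    unfolding jacobi_P_def by (simp add: mult_ac)
  then show ?thesis
    by (simp add: power_mult_distrib power_divide flip: power_mult)
       (simp add: mult.commute[of _ 2] power_mult)
qed

section \<open>Ratios of Gamma values\<close>

lemma Gamma_plus1_pos:
  fixes x :: real
  shows "x > 0 \<Longrightarrow> Gamma (x + 1) = x * Gamma x"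
  by (rule Gamma_plus1) (auto elim!: nonpos_Ints_cases)

lemma Gamma_half_step_ratio_ge:
  fixes z :: real
  assumes "z > 0"
  shows "1 / (z + 1/2) \<le> (Gamma (z + 1/2) / Gamma (z + 1))\<^sup>2"
proof -
  \<comment> \<open>Log-convexity at the midpoint \<open>z + 1\<close> of \<open>z + 1/2\<close> and \<open>z + 3/2\<close>.\<close>
  have pos: "Gamma (z + 1/2) > 0" "Gamma (z + 1) > 0" "Gamma (z + 3/2) > 0"
    using assms by (auto intro!: Gamma_real_pos)
  have "(ln \<circ> Gamma) ((1 - 1/2) *\<^sub>R (z + 1/2) + (1/2) *\<^sub>R (z + 3/2))
      \<le> (1 - 1/2) * (ln \<circ> Gamma) (z + 1/2) + (1/2) * (ln \<circ> Gamma) (z + 3/2)"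
    by (rule convex_onD[OF log_convex_Gamma_real]) (use assms in auto)
  moreover have "(1 - 1/2) *\<^sub>R (z + 1/2) + (1/2) *\<^sub>R (z + 3/2) = z + 1" by (simp add: field_simps)
  ultimately have "2 * ln (Gamma (z + 1)) \<le> ln (Gamma (z + 1/2)) + ln (Gamma (z + 3/2))" by simp
  then have "ln ((Gamma (z + 1))\<^sup>2) \<le> ln (Gamma (z + 1/2) * Gamma (z + 3/2))"
    using pos by (simp add: ln_mult ln_realpow)
  then have "(Gamma (z + 1))\<^sup>2 \<le> Gamma (z + 1/2) * Gamma (z + 3/2)"
    using pos by simp
  also have "Gamma (z + 3/2) = (z + 1/2) * Gamma (z + 1/2)"
    using Gamma_plus1_pos[of "z + 1/2"] assms by (simp add: add.assoc)
  finally have "(Gamma (z + 1))\<^sup>2 \<le> (z + 1/2) * (Gamma (z + 1/2))\<^sup>2"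
    by (simp add: power2_eq_square mult_ac)
  moreover have "1 / w \<le> (A / B)\<^sup>2" if "w > 0" "B > 0" "B\<^sup>2 \<le> w * A\<^sup>2" for A B w :: real
    using that by (simp add: field_simps)
  ultimately show ?thesis using pos assms by (metis add_pos_pos half_gt_zero_iff zero_less_one)
qed

text \<open>
  The quantity \<open>(Gamma (z + 1/2) / Gamma (z + 1))\<^sup>2 * (z + 1/3)\<close> decreases under \<open>z \<mapsto> z + 1\<close>, and
  the cruder bound above shows that its limit is at least 1.  The shift \<open>1/3\<close> is the least one for
  which it decreases for all \<open>z > 0\<close>; the asymptotically sharp \<open>1/4\<close> would make it increase.
\<close>

lemma Gamma_half_step_ratio_ge_sharp:
  fixes z :: real
  assumes "z > 0"
  shows "1 / (z + 1/3) \<le> (Gamma (z + 1/2) / Gamma (z + 1))\<^sup>2"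
proof -
  define G where "G = (\<lambda>z::real. (Gamma (z + 1/2) / Gamma (z + 1))\<^sup>2)"
  define h where "h = (\<lambda>n. G (z + real n) * (z + real n + 1/3))"
  have Grec: "G (y + 1) = ((y + 1/2) / (y + 1))\<^sup>2 * G y" if "y > 0" for y
  proof -
    have "Gamma (y + 1 + 1/2) = (y + 1/2) * Gamma (y + 1/2)"
      using Gamma_plus1_pos[of "y + 1/2"] that by (simp add: add_ac)
    moreover have "Gamma (y + 1 + 1) = (y + 1) * Gamma (y + 1)"
      using Gamma_plus1_pos[of "y + 1"] that by (simp add: add_ac)
    ultimately show ?thesis unfolding G_def by (simp add: power_divide power_mult_distrib)
  qed
  have Gpos: "G y > 0" if "y > 0" for y
  proof -
    have "Gamma (y + 1/2) > 0" "Gamma (y + 1) > 0" using that by (auto intro!: Gamma_real_pos)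
    then show ?thesis unfolding G_def by (intro zero_less_power divide_pos_pos)
  qed
  have dec: "h (Suc n) \<le> h n" for n
  proof -
    let ?y = "z + real n"
    have y: "?y > 0" using assms by simp
    have "(?y + 1/2)\<^sup>2 * (?y + 1 + 1/3) \<le> (?y + 1)\<^sup>2 * (?y + 1/3)"
      using y by (simp add: power2_eq_square algebra_simps)
    then have "((?y + 1/2) / (?y + 1))\<^sup>2 * (?y + 1 + 1/3) \<le> ?y + 1/3"
      using y by (simp add: power_divide divide_le_eq mult.commute)
    then have "G ?y * (((?y + 1/2) / (?y + 1))\<^sup>2 * (?y + 1 + 1/3)) \<le> G ?y * (?y + 1/3)"
      using Gpos[OF y] by (intro mult_left_mono) auto
    then show ?thesis unfolding h_def using Grec[OF y] by (simp add: algebra_simps)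
  qed
  have anti: "h n \<le> h 0" for n by (induction n) (use dec order_trans in blast)+
  have low: "(z + real n + 1/3) / (z + real n + 1/2) \<le> h 0" for n
  proof -
    have "1 / (z + real n + 1/2) \<le> G (z + real n)"
      unfolding G_def by (rule Gamma_half_step_ratio_ge) (use assms in auto)
    then have "1 / (z + real n + 1/2) * (z + real n + 1/3) \<le> h n"
      unfolding h_def using assms by (intro mult_right_mono) auto
    then show ?thesis using anti[of n] by simp
  qed
  have "(\<lambda>n. (z + real n + 1/3) / (z + real n + 1/2)) \<longlonglongrightarrow> 1"
    by real_asymp
  then have "1 \<le> h 0"
    by (rule LIMSEQ_le_const2) (use low in auto)
  then have "1 / (z + 1/3) \<le> G z" using assms by (simp add: h_def pos_divide_le_eq)
  then show ?thesis unfolding G_def .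
qed

lemma Gamma_legendre_duplication_real:
  fixes z :: real
  assumes "z > 0"
  shows "Gamma z * Gamma (z + 1/2) = 2 powr (1 - 2 * z) * sqrt pi * Gamma (2 * z)"
proof -
  have z: "complex_of_real z \<notin> \<int>\<^sub>\<le>\<^sub>0" "complex_of_real z + 1/2 \<notin> \<int>\<^sub>\<le>\<^sub>0"
    using assms by (auto elim!: nonpos_Ints_cases simp: complex_eq_iff)
  have "complex_of_real (Gamma z * Gamma (z + 1/2))
      = Gamma (of_real z) * Gamma (of_real z + 1/2)"
    by (simp flip: Gamma_complex_of_real)
  also have "\<dots> = exp ((1 - 2 * of_real z) * of_real (ln 2)) * of_real (sqrt pi) * Gamma (2 * of_real z)"
    by (rule Gamma_legendre_duplication[OF z])
  also have "exp ((1 - 2 * of_real z) * complex_of_real (ln 2)) = of_real (2 powr (1 - 2 * z))"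
    by (simp add: powr_def flip: exp_of_real)
  also have "Gamma (2 * complex_of_real z) = of_real (Gamma (2 * z))"
    by (simp flip: Gamma_complex_of_real)
  finally show ?thesis by (simp flip: of_real_mult)
qed

text \<open>The central value of a symmetric binomial, in terms of the half-step ratio.\<close>

lemma Gamma_central_ratio:
  fixes z :: real
  assumes "z > -1/2"
  shows "Gamma (2 * z + 1) / (Gamma (z + 1))\<^sup>2
       = 2 powr (2 * z) / sqrt pi * (Gamma (z + 1/2) / Gamma (z + 1))"
proof -
  have "Gamma (z + 1/2) * Gamma (z + 1) = 2 powr (- (2 * z)) * sqrt pi * Gamma (2 * z + 1)"
    using Gamma_legendre_duplication_real[of "z + 1/2"] assms by (simp add: algebra_simps)
  moreover have "Gamma (z + 1) > 0" using assms by (intro Gamma_real_pos) auto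
  ultimately show ?thesis
    by (simp add: powr_minus field_simps power2_eq_square)
qed

section \<open>The normalised polynomial at the origin\<close>

text \<open>
  Both \<open>k!\<close> and \<open>Gamma (k + 2 * \<alpha> + 1)\<close> pair up with the squares in the binomial coefficient to
  central ratios, one at \<open>k / 2\<close> and one at \<open>k / 2 + \<alpha>\<close>; all powers of 2 cancel but one.
\<close>

lemma orthonormal_ultraspherical_at_zero:
  fixes \<alpha> :: real
  assumes k: "k = 2 * m" and pos: "real m + \<alpha> > 0"
  defines "G \<equiv> \<lambda>z::real. Gamma (z + 1/2) / Gamma (z + 1)"
  shows "(orthonormal_ultraspherical k \<alpha> 0)\<^sup>2
       = (2 * (real k + \<alpha>) + 1) / (2 * pi) * (G (real m) * G (real m + \<alpha>))"
proof -
  define s where "s = real k + \<alpha>"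
  have s: "s > 0" "s - real m = real m + \<alpha>" using k pos by (auto simp: s_def)
  have G1: "Gamma (s + 1) > 0" "Gamma (real m + \<alpha> + 1) > 0"
      "Gamma (real k + 2 * \<alpha> + 1) > 0"
    using s pos k by (auto intro!: Gamma_real_pos)
  have C: "s gchoose m = Gamma (s + 1) / (fact m * Gamma (real m + \<alpha> + 1))"
  proof -
    have "s + 1 \<notin> \<int>\<^sub>\<le>\<^sub>0" using s(1) by (auto elim!: nonpos_Ints_cases)
    from gbinomial_Gamma[OF this, of m] show ?thesis using s(2) by simp
  qed
  have k_ratio: "fact k / (fact m)\<^sup>2 = 2 ^ k / sqrt pi * G (real m)"
  proof -
    have "Gamma (1 + real n) = fact n" for n by (rule Gamma_fact)
    then have "Gamma (real m + 1) = fact m" "Gamma (2 * real m + 1) = fact k"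
      using k by (metis add.commute, metis add.commute of_nat_mult of_nat_numeral)
    moreover have "2 powr (2 * real m) = 2 ^ k"
      using k powr_realpow[of 2 k] by simp
    ultimately show ?thesis
      using Gamma_central_ratio[of "real m"] unfolding G_def by simp
  qed
  have nu_ratio: "Gamma (real k + 2 * \<alpha> + 1) / (Gamma (real m + \<alpha> + 1))\<^sup>2
        = 2 powr (real k + 2 * \<alpha>) / sqrt pi * G (real m + \<alpha>)"
    using Gamma_central_ratio[of "real m + \<alpha>"] pos k
    by (simp only: G_def) (simp add: algebra_simps)
  have Lpos: "ultraspherical_norm_sq k \<alpha> > 0"
  proof -
    have "0 < 2 * real k + 2 * \<alpha> + 1" using s(1) pos k by simp
    moreover have "0 < (2 :: real) powr (2 * \<alpha> + 1)" "0 < (fact k :: real)" by simp_all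
    ultimately show ?thesis
      unfolding ultraspherical_norm_sq_def
      by (intro divide_pos_pos mult_pos_pos G1 zero_less_power G1(1)[unfolded s_def])
  qed
  have "(orthonormal_ultraspherical k \<alpha> 0)\<^sup>2 = (s gchoose m)\<^sup>2 / 4 ^ k / ultraspherical_norm_sq k \<alpha>"
    unfolding orthonormal_ultraspherical_def power_divide jacobi_P_at_zero[OF k] s_def
    using Lpos by simp
  also have "\<dots> = (2 * s + 1) / (4 ^ k * 2 powr (2 * \<alpha> + 1)) * (fact k / (fact m)\<^sup>2)
       * (Gamma (real k + 2 * \<alpha> + 1) / (Gamma (real m + \<alpha> + 1))\<^sup>2)"
    unfolding C ultraspherical_norm_sq_def using G1
    by (simp add: s_def power_divide power_mult_distrib field_simps)
  also have "\<dots> = (2 * s + 1) / pi * (G (real m) * G (real m + \<alpha>))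
       * (2 ^ k * 2 powr (real k + 2 * \<alpha>) / (4 ^ k * 2 powr (2 * \<alpha> + 1)))"
    unfolding k_ratio nu_ratio by (simp add: field_simps)
  also have "2 ^ k * 2 powr (real k + 2 * \<alpha>) / (4 ^ k * 2 powr (2 * \<alpha> + 1)) = (1/2 :: real)"
  proof -
    have "(4 :: real) ^ k = 2 ^ k * 2 ^ k" by (simp flip: power_mult_distrib)
    then show ?thesis by (simp add: powr_add powr_realpow)
  qed
  finally show ?thesis by (simp add: s_def)
qed

lemma orthonormal_ultraspherical_at_zero_ge:
  fixes \<alpha> :: real
  assumes k: "k = 2 * m" and "m > 0" and pos: "real m + \<alpha> > 0"
  shows "(2 * (real k + \<alpha>) + 1) / (pi * sqrt ((real k + 2/3) * (real k + 2 * \<alpha> + 2/3)))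
       \<le> (orthonormal_ultraspherical k \<alpha> 0)\<^sup>2"
proof -
  define G where "G = (\<lambda>z::real. Gamma (z + 1/2) / Gamma (z + 1))"
  have G_ge: "1 / sqrt (z + 1/3) \<le> G z" if "z > 0" for z
  proof -
    have "G z > 0" unfolding G_def using that by (intro divide_pos_pos Gamma_real_pos) auto
    moreover have "sqrt (1 / (z + 1/3)) \<le> sqrt ((G z)\<^sup>2)"
      using Gamma_half_step_ratio_ge_sharp[OF that] unfolding G_def by (rule real_sqrt_le_mono)
    ultimately show ?thesis by (simp add: real_sqrt_divide)
  qed
  have mpos: "real m > 0" using assms by simp
  have "1 / sqrt (real m + 1/3) * (1 / sqrt (real m + \<alpha> + 1/3)) \<le> G (real m) * G (real m + \<alpha>)"
    using G_ge[OF mpos] G_ge[OF pos] mpos pos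
    by (intro mult_mono) (auto intro: order_trans[of _ "1 / sqrt (real m + 1/3)"])
  moreover have "(real k + 2/3) * (real k + 2 * \<alpha> + 2/3)
       = 2\<^sup>2 * ((real m + 1/3) * (real m + \<alpha> + 1/3))"
    using k by (simp add: power2_eq_square algebra_simps)
  then have "sqrt ((real k + 2/3) * (real k + 2 * \<alpha> + 2/3))
       = 2 * (sqrt (real m + 1/3) * sqrt (real m + \<alpha> + 1/3))"
    by (simp add: real_sqrt_mult)
  ultimately have "2 / sqrt ((real k + 2/3) * (real k + 2 * \<alpha> + 2/3)) \<le> G (real m) * G (real m + \<alpha>)"
    by simp
  moreover have "0 \<le> (2 * (real k + \<alpha>) + 1) / (2 * pi)" using k pos by simp
  ultimately have "(2 * (real k + \<alpha>) + 1) / (2 * pi) * (2 / sqrt ((real k + 2/3) * (real k + 2 * \<alpha> + 2/3)))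
      \<le> (2 * (real k + \<alpha>) + 1) / (2 * pi) * (G (real m) * G (real m + \<alpha>))"
    by (rule mult_left_mono)
  moreover have "(orthonormal_ultraspherical k \<alpha> 0)\<^sup>2
      = (2 * (real k + \<alpha>) + 1) / (2 * pi) * (G (real m) * G (real m + \<alpha>))"
    unfolding G_def by (rule orthonormal_ultraspherical_at_zero[OF k pos])
  moreover have "c / (2 * pi) * (2 / q) = c / (pi * q)" for c q :: real by simp
  ultimately show ?thesis by metis
qed

section \<open>The angle divided by its sine\<close>

lemma le_zero_of_nonpos_derivative:
  fixes f f' :: "real \<Rightarrow> real"
  assumes "\<And>x. (f has_real_derivative f' x) (at x)" and "f 0 = 0"
    and "\<And>x. \<lbrakk>0 \<le> x; x \<le> b\<rbrakk> \<Longrightarrow> f' x \<le> 0" and "0 \<le> x" "x \<le> b"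
  shows "f x \<le> 0"
proof -
  have "f x \<le> f 0" using assms(4)
    by (rule DERIV_nonpos_imp_nonincreasing) (use assms in \<open>meson order_trans\<close>)
  then show ?thesis using assms(2) by simp
qed

lemma ge_zero_of_nonneg_derivative:
  fixes f f' :: "real \<Rightarrow> real"
  assumes "\<And>x. (f has_real_derivative f' x) (at x)" and "f 0 = 0"
    and "\<And>x. \<lbrakk>0 \<le> x; x \<le> b\<rbrakk> \<Longrightarrow> 0 \<le> f' x" and "0 \<le> x" "x \<le> b"
  shows "0 \<le> f x"
proof -
  have "f 0 \<le> f x" using assms(4)
    by (rule DERIV_nonneg_imp_nondecreasing) (use assms in \<open>meson order_trans\<close>)
  then show ?thesis using assms(2) by simp
qed

text \<open>
  These four functions are \<open>sin \<theta> ^ (2 * n + 1)\<close> times the \<open>n\<close>-th derivative of \<open>\<theta> / sin \<theta>\<close> with respect to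
  \<open>cos \<theta>\<close>, for \<open>n = 1, 2, 3, 4\<close>.
\<close>

definition angle_num1 :: "real \<Rightarrow> real" where
  "angle_num1 \<theta> = \<theta> * cos \<theta> - sin \<theta>"

definition angle_num2 :: "real \<Rightarrow> real" where
  "angle_num2 \<theta> = 3 * cos \<theta> * angle_num1 \<theta> + (sin \<theta>)\<^sup>2 * \<theta>"

definition angle_num3 :: "real \<Rightarrow> real" where
  "angle_num3 \<theta> = 5 * cos \<theta> * angle_num2 \<theta> + 4 * (sin \<theta>)\<^sup>2 * angle_num1 \<theta>"

definition angle_num4 :: "real \<Rightarrow> real" where
  "angle_num4 \<theta> = 7 * cos \<theta> * angle_num3 \<theta> + 9 * (sin \<theta>)\<^sup>2 * angle_num2 \<theta>"

lemma angle_num_derivs: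
  "(angle_num1 has_real_derivative - sin \<theta> * \<theta>) (at \<theta>)"
  "(angle_num2 has_real_derivative - 4 * sin \<theta> * angle_num1 \<theta>) (at \<theta>)"
  "(angle_num3 has_real_derivative - 9 * sin \<theta> * angle_num2 \<theta>) (at \<theta>)"
  "(angle_num4 has_real_derivative - 16 * sin \<theta> * angle_num3 \<theta>) (at \<theta>)"
proof -
  show 1: "(angle_num1 has_real_derivative - sin \<theta> * \<theta>) (at \<theta>)"
    unfolding angle_num1_def by (auto intro!: derivative_eq_intros)
  show 2: "(angle_num2 has_real_derivative - 4 * sin \<theta> * angle_num1 \<theta>) (at \<theta>)"
    unfolding angle_num2_def
    by (rule derivative_eq_intros 1 refl)+
       (simp add: angle_num1_def algebra_simps power2_eq_square)
  show 3: "(angle_num3 has_real_derivative - 9 * sin \<theta> * angle_num2 \<theta>) (at \<theta>)"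
    unfolding angle_num3_def
    by (rule derivative_eq_intros 1 2 refl)+
       (simp add: angle_num2_def algebra_simps power2_eq_square)
  show "(angle_num4 has_real_derivative - 16 * sin \<theta> * angle_num3 \<theta>) (at \<theta>)"
    unfolding angle_num4_def
    by (rule derivative_eq_intros 1 2 3 refl)+
       (simp add: angle_num3_def algebra_simps power2_eq_square)
qed

text \<open>
  All four functions vanish at 0, and the \<open>n\<close>-th has derivative \<open>- n\<^sup>2 * sin \<theta>\<close> times its predecessor
  (the predecessor of the first being \<open>\<theta>\<close>), so the signs alternate.
\<close>

lemma angle_num_signs:
  assumes "0 \<le> \<theta>" "\<theta> \<le> pi"
  shows "angle_num1 \<theta> \<le> 0" "0 \<le> angle_num2 \<theta>" "angle_num3 \<theta> \<le> 0" "0 \<le> angle_num4 \<theta>"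
proof -
  have s: "0 \<le> sin x" if "0 \<le> x" "x \<le> pi" for x using that sin_ge_zero by auto
  have 1: "angle_num1 x \<le> 0" if "0 \<le> x" "x \<le> pi" for x
    using angle_num_derivs(1) by (rule le_zero_of_nonpos_derivative) (use s that in \<open>auto simp: angle_num1_def\<close>)
  have 2: "0 \<le> angle_num2 x" if "0 \<le> x" "x \<le> pi" for x
    using angle_num_derivs(2) by (rule ge_zero_of_nonneg_derivative)
      (use s 1 that in \<open>auto simp: angle_num2_def angle_num1_def mult_nonneg_nonpos\<close>)
  have 3: "angle_num3 x \<le> 0" if "0 \<le> x" "x \<le> pi" for x
    using angle_num_derivs(3) by (rule le_zero_of_nonpos_derivative)
      (use s 2 that in \<open>auto simp: angle_num3_def angle_num2_def angle_num1_def\<close>)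
  have 4: "0 \<le> angle_num4 x" if "0 \<le> x" "x \<le> pi" for x
    using angle_num_derivs(4) by (rule ge_zero_of_nonneg_derivative)
      (use s 3 that in \<open>auto simp: angle_num4_def angle_num3_def angle_num2_def angle_num1_def mult_nonneg_nonpos\<close>)
  show "angle_num1 \<theta> \<le> 0" "0 \<le> angle_num2 \<theta>" "angle_num3 \<theta> \<le> 0" "0 \<le> angle_num4 \<theta>"
    using assms 1 2 3 4 by auto
qed

lemma angle_num1_cubic_bound:
  assumes "0 \<le> \<theta>"
  shows "- angle_num1 \<theta> \<le> \<theta> ^ 3 / 3"
proof -
  have "0 \<le> \<theta> ^ 3 / 3 + angle_num1 \<theta>"
  proof (rule ge_zero_of_nonneg_derivative[where f = "\<lambda>x. x ^ 3 / 3 + angle_num1 x" and x = \<theta> and b = \<theta> and f' = "\<lambda>x. x\<^sup>2 - sin x * x"])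
    show "((\<lambda>x. x ^ 3 / 3 + angle_num1 x) has_real_derivative x\<^sup>2 - sin x * x) (at x)" for x
      by (auto intro!: derivative_eq_intros angle_num_derivs(1) simp: power2_eq_square)
    show "0 \<le> x\<^sup>2 - sin x * x" if "0 \<le> x" "x \<le> \<theta>" for x
      using that sin_x_le_x[of x] mult_right_mono[of "sin x" x x] by (simp add: power2_eq_square)
  qed (use assms in \<open>auto simp: angle_num1_def\<close>)
  then show ?thesis by simp
qed

text \<open>
  In terms of \<open>t = cos \<theta>\<close> and \<open>f t = \<theta> / sin \<theta>\<close> this says \<open>t * f'' t + f' t \<le> 0\<close>.  Differentiating twice and
  stripping a factor \<open>sin \<theta>\<close> each time leads back to \<open>\<theta> * cos \<theta> \<le> sin \<theta>\<close>.
\<close>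

lemma angle_num_combination_nonpos:
  assumes "0 \<le> \<theta>" "\<theta> \<le> pi"
  shows "cos \<theta> * angle_num2 \<theta> + (sin \<theta>)\<^sup>2 * angle_num1 \<theta> \<le> 0"
proof -
  define h where "h = (\<lambda>x::real. 5 * sin x * cos x - x * (2 + 3 * (cos x)\<^sup>2))"
  have h: "h x \<le> 0" if "0 \<le> x" "x \<le> pi" for x
  proof (rule le_zero_of_nonpos_derivative[where f = h and x = x and b = pi and f' = "\<lambda>x. sin x * (6 * angle_num1 x - sin x)"])
    show "(h has_real_derivative sin x * (6 * angle_num1 x - sin x)) (at x)" for x
      unfolding h_def
      apply (rule derivative_eq_intros refl)+
      apply (simp add: angle_num1_def)
      using sin_cos_squared_add[of x] by algebra
    show "sin x * (6 * angle_num1 x - sin x) \<le> 0" if "0 \<le> x" "x \<le> pi" for x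
      using angle_num_signs(1)[OF that] sin_ge_zero[OF that] by (intro mult_nonneg_nonpos) auto
  qed (use that in \<open>auto simp: h_def\<close>)
  show ?thesis
  proof (rule le_zero_of_nonpos_derivative[where x = \<theta> and b = pi and f' = "\<lambda>x. sin x * h x" and
        f = "\<lambda>\<theta>. cos \<theta> * angle_num2 \<theta> + (sin \<theta>)\<^sup>2 * angle_num1 \<theta>"])
    show "((\<lambda>\<theta>. cos \<theta> * angle_num2 \<theta> + (sin \<theta>)\<^sup>2 * angle_num1 \<theta>) has_real_derivative sin x * h x) (at x)" for x
      unfolding h_def
      apply (rule derivative_eq_intros angle_num_derivs refl)+
      apply (simp add: angle_num1_def angle_num2_def)
      using sin_cos_squared_add[of x] by algebra
    show "sin x * h x \<le> 0" if "0 \<le> x" "x \<le> pi" for x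
      using h[OF that] sin_ge_zero[OF that] by (intro mult_nonneg_nonpos) auto
  qed (use assms in \<open>auto simp: angle_num1_def angle_num2_def\<close>)
qed

definition inv_sin :: "real \<Rightarrow> real" where
  "inv_sin t = 1 / sqrt (1 - t\<^sup>2)"

text \<open>
  The angle \<open>\<theta>\<close> over \<open>sin \<theta>\<close> as a function of \<open>t = cos \<theta>\<close>, followed by its derivatives in the recursive
  form that comes from \<open>(1 - t\<^sup>2) f' = t f - 1\<close>.
\<close>

definition angle_ratio :: "real \<Rightarrow> real" where
  "angle_ratio t = arccos t * inv_sin t"

definition angle_ratio1 :: "real \<Rightarrow> real" where
  "angle_ratio1 t = (t * angle_ratio t - 1) * (inv_sin t)\<^sup>2"

definition angle_ratio2 :: "real \<Rightarrow> real" where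
  "angle_ratio2 t = (3 * t * angle_ratio1 t + angle_ratio t) * (inv_sin t)\<^sup>2"

definition angle_ratio3 :: "real \<Rightarrow> real" where
  "angle_ratio3 t = (5 * t * angle_ratio2 t + 4 * angle_ratio1 t) * (inv_sin t)\<^sup>2"

definition angle_ratio4 :: "real \<Rightarrow> real" where
  "angle_ratio4 t = (7 * t * angle_ratio3 t + 9 * angle_ratio2 t) * (inv_sin t)\<^sup>2"

lemma abs_less_one_square: "-1 < t \<Longrightarrow> t < 1 \<Longrightarrow> 1 - t\<^sup>2 > (0::real)"
  by (simp add: abs_square_less_1 abs_less_iff)

lemma inv_sin_pos: "-1 < t \<Longrightarrow> t < 1 \<Longrightarrow> inv_sin t > 0"
  unfolding inv_sin_def using abs_less_one_square by simp

lemma inv_sin_sq: "-1 < t \<Longrightarrow> t < 1 \<Longrightarrow> (1 - t\<^sup>2) * (inv_sin t)\<^sup>2 = 1"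
  unfolding inv_sin_def using abs_less_one_square[of t] by (simp add: power_divide)

lemma inv_sin_cos: "0 < \<theta> \<Longrightarrow> \<theta> < pi \<Longrightarrow> inv_sin (cos \<theta>) = 1 / sin \<theta>"
  unfolding inv_sin_def using sin_gt_zero[of \<theta>]
  by (simp add: sin_squared_eq[symmetric])

lemma inv_sin_deriv:
  assumes "-1 < t" "t < 1"
  shows "(inv_sin has_real_derivative t * inv_sin t ^ 3) (at t)"
proof -
  have p: "1 - t\<^sup>2 > 0" using abs_less_one_square assms by simp
  have "((\<lambda>t. 1 / sqrt (1 - t\<^sup>2)) has_real_derivative t * (1 / sqrt (1 - t\<^sup>2)) ^ 3) (at t)"
    using p by (auto intro!: derivative_eq_intros simp: power3_eq_cube power2_eq_square field_simps)
  then show ?thesis unfolding inv_sin_def[abs_def] .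
qed

lemma inv_sin_power_deriv:
  assumes "-1 < t" "t < 1"
  shows "((\<lambda>t. inv_sin t ^ n) has_real_derivative real n * t * inv_sin t ^ (n + 2)) (at t)"
proof (cases n)
  case (Suc m)
  show ?thesis unfolding Suc
    by (rule derivative_eq_intros inv_sin_deriv[OF assms] refl)+ (simp add: power3_eq_cube)
qed simp

lemma angle_ratio_derivs:
  assumes "-1 < t" "t < 1"
  shows "(angle_ratio has_real_derivative angle_ratio1 t) (at t)"
    and "(angle_ratio1 has_real_derivative angle_ratio2 t) (at t)"
    and "(angle_ratio2 has_real_derivative angle_ratio3 t) (at t)"
    and "(angle_ratio3 has_real_derivative angle_ratio4 t) (at t)"
proof -
  let ?g = "inv_sin t"
  have gg: "(1 - t\<^sup>2) * ?g\<^sup>2 = 1" by (rule inv_sin_sq[OF assms])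
  have ac: "(arccos has_real_derivative - ?g) (at t)"
    using DERIV_arccos[OF assms] by (simp add: inv_sin_def inverse_eq_divide)
  note g2 = inv_sin_power_deriv[OF assms, of 2]
  show 0: "(angle_ratio has_real_derivative angle_ratio1 t) (at t)"
    unfolding angle_ratio_def[abs_def] angle_ratio1_def
    by (rule DERIV_cong[OF DERIV_mult[OF ac inv_sin_deriv[OF assms]]])
       (simp add: algebra_simps power2_eq_square power3_eq_cube)
  show 1: "(angle_ratio1 has_real_derivative angle_ratio2 t) (at t)"
    unfolding angle_ratio1_def[abs_def] angle_ratio2_def
    apply (rule DERIV_cong)
     apply (rule DERIV_mult[OF _ g2] DERIV_diff DERIV_mult DERIV_const DERIV_ident 0)+
    using gg unfolding angle_ratio1_def by (simp add: algebra_simps)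
  show 2: "(angle_ratio2 has_real_derivative angle_ratio3 t) (at t)"
    unfolding angle_ratio2_def[abs_def] angle_ratio3_def
    apply (rule DERIV_cong)
     apply (rule DERIV_mult[OF _ g2] DERIV_add DERIV_cmult DERIV_mult DERIV_const DERIV_ident 0 1)+
    using gg unfolding angle_ratio2_def by (simp add: algebra_simps)
  show "(angle_ratio3 has_real_derivative angle_ratio4 t) (at t)"
    unfolding angle_ratio3_def[abs_def] angle_ratio4_def
    apply (rule DERIV_cong)
     apply (rule DERIV_mult[OF _ g2] DERIV_add DERIV_cmult DERIV_mult DERIV_const DERIV_ident 1 2)+
    using gg unfolding angle_ratio3_def by (simp add: algebra_simps)
qed

lemma angle_ratio_cos:
  assumes "0 < \<theta>" "\<theta> < pi"
  shows "angle_ratio (cos \<theta>) = \<theta> / sin \<theta>"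
    and "angle_ratio1 (cos \<theta>) = angle_num1 \<theta> / sin \<theta> ^ 3"
    and "angle_ratio2 (cos \<theta>) = angle_num2 \<theta> / sin \<theta> ^ 5"
    and "angle_ratio3 (cos \<theta>) = angle_num3 \<theta> / sin \<theta> ^ 7"
    and "angle_ratio4 (cos \<theta>) = angle_num4 \<theta> / sin \<theta> ^ 9"
proof -
  have s: "sin \<theta> > 0" using assms by (rule sin_gt_zero)
  have arc: "arccos (cos \<theta>) = \<theta>" using assms by (intro arccos_cos) auto
  show 0: "angle_ratio (cos \<theta>) = \<theta> / sin \<theta>"
    unfolding angle_ratio_def arc inv_sin_cos[OF assms] by simp
  show 1: "angle_ratio1 (cos \<theta>) = angle_num1 \<theta> / sin \<theta> ^ 3"
    unfolding angle_ratio1_def 0 inv_sin_cos[OF assms] angle_num1_def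
    using s by (simp add: field_simps power2_eq_square power3_eq_cube)
  show 2: "angle_ratio2 (cos \<theta>) = angle_num2 \<theta> / sin \<theta> ^ 5"
    unfolding angle_ratio2_def 0 1 inv_sin_cos[OF assms] angle_num2_def
    using s by (simp add: field_simps eval_nat_numeral)
  show 3: "angle_ratio3 (cos \<theta>) = angle_num3 \<theta> / sin \<theta> ^ 7"
    unfolding angle_ratio3_def 1 2 inv_sin_cos[OF assms] angle_num3_def
    using s by (simp add: field_simps eval_nat_numeral)
  show "angle_ratio4 (cos \<theta>) = angle_num4 \<theta> / sin \<theta> ^ 9"
    unfolding angle_ratio4_def 2 3 inv_sin_cos[OF assms] angle_num4_def
    using s by (simp add: field_simps eval_nat_numeral)
qed

lemma angle_ratio_at_zero:
  "inv_sin 0 = 1" "angle_ratio 0 = pi / 2" "angle_ratio1 0 = - 1" "angle_ratio2 0 = pi / 2"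
  "angle_ratio3 0 = - 4"
  by (simp_all add: inv_sin_def angle_ratio_def angle_ratio1_def angle_ratio2_def angle_ratio3_def)

text \<open>
  The bound \<open>- 4\<close> is the value at \<open>t = 0\<close> of the third derivative, which increases because the fourth
  derivative is nonnegative.  The last bound is what controls the first derivative near \<open>t = 1\<close>,
  where \<open>inv_sin\<close> itself is unbounded.
\<close>

lemma angle_ratio_bounds:
  assumes "0 \<le> t" "t < 1"
  shows "angle_ratio1 t \<le> 0" "0 \<le> angle_ratio2 t" "angle_ratio3 t \<ge> - 4"
    and "t * angle_ratio2 t + angle_ratio1 t \<le> 0"
    and "- angle_ratio1 t \<le> (arccos t * inv_sin t) ^ 3 / 3"
proof -
  have via_angle: "angle_ratio1 t \<le> 0 \<and> 0 \<le> angle_ratio2 t \<and> 0 \<le> angle_ratio4 t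
      \<and> t * angle_ratio2 t + angle_ratio1 t \<le> 0
      \<and> - angle_ratio1 t \<le> (arccos t * inv_sin t) ^ 3 / 3" if t: "0 \<le> t" "t < 1" for t
  proof -
    define \<theta> where "\<theta> = arccos t"
    have c: "cos \<theta> = t" unfolding \<theta>_def using t by (intro cos_arccos) auto
    have \<theta>: "0 < \<theta>" "\<theta> < pi"
      using arccos_lt_bounded[of t] t unfolding \<theta>_def by auto
    then have le: "0 \<le> \<theta>" "\<theta> \<le> pi" by auto
    have s: "sin \<theta> > 0" using \<theta> by (rule sin_gt_zero)
    note sg = angle_num_signs[OF le] and ar = angle_ratio_cos[OF \<theta>, unfolded c]
    have "t * angle_ratio2 t + angle_ratio1 t
        = (cos \<theta> * angle_num2 \<theta> + (sin \<theta>)\<^sup>2 * angle_num1 \<theta>) / sin \<theta> ^ 5"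
      unfolding ar using s c by (simp add: field_simps eval_nat_numeral)
    also have "\<dots> \<le> 0"
      using angle_num_combination_nonpos[OF le] s by (simp add: divide_nonpos_pos)
    finally have comb: "t * angle_ratio2 t + angle_ratio1 t \<le> 0" .
    have "- angle_ratio1 t = - angle_num1 \<theta> / sin \<theta> ^ 3" unfolding ar by simp
    also have "\<dots> \<le> (\<theta> ^ 3 / 3) / sin \<theta> ^ 3"
      using angle_num1_cubic_bound[OF le(1)] s by (intro divide_right_mono) auto
    also have "\<dots> = (arccos t * inv_sin t) ^ 3 / 3"
      using inv_sin_cos[OF \<theta>] c by (simp add: \<theta>_def power_mult_distrib power_divide)
    finally show ?thesis using comb sg s unfolding ar
      by (auto simp: divide_nonpos_pos)
  qed
  show "angle_ratio1 t \<le> 0" "0 \<le> angle_ratio2 t"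
    "t * angle_ratio2 t + angle_ratio1 t \<le> 0"
    "- angle_ratio1 t \<le> (arccos t * inv_sin t) ^ 3 / 3"
    using via_angle[OF assms] by auto
  have "angle_ratio3 0 \<le> angle_ratio3 t" using assms(1)
  proof (rule DERIV_nonneg_imp_nondecreasing)
    fix x assume x: "0 \<le> x" "x \<le> t"
    show "\<exists>y. (angle_ratio3 has_real_derivative y) (at x) \<and> 0 \<le> y"
      using angle_ratio_derivs(4)[of x] via_angle[of x] x assms by auto
  qed
  then show "angle_ratio3 t \<ge> - 4" by (simp add: angle_ratio_at_zero)
qed

section \<open>The energy form of an oscillator\<close>

text \<open>
  The arguments \<open>p\<close>, \<open>p1\<close>, \<open>p2\<close> stand for a function and its first two derivatives at \<open>t\<close>, and \<open>z\<close>, \<open>z1\<close> for a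
  solution and its derivative.
\<close>

definition energy_form :: "real \<Rightarrow> real \<Rightarrow> real \<Rightarrow> real \<Rightarrow> real \<Rightarrow> real \<Rightarrow> real \<Rightarrow> real \<Rightarrow> real" where
  "energy_form \<rho> D t p p1 p2 z z1 =
     - (\<rho> / 2) * ((1 - D * t\<^sup>2) * p) * z1\<^sup>2
     + (\<rho> / 2) * ((1 - D * t\<^sup>2) * p1 - 2 * D * t * p) * (z * z1)
     - ((1 - t\<^sup>2) * p / (2 * (1 - D * t\<^sup>2))
        + (\<rho> / 4) * ((1 - D * t\<^sup>2) * p2 - 4 * D * t * p1 - 2 * D * p)) * z\<^sup>2"

text \<open>
  For \<open>c = - (\<rho> / 2) * (1 - D * t\<^sup>2) * p t\<close> the form is \<open>c z'\<^sup>2 - c' z z' + (c Q + c'' / 2) z\<^sup>2\<close>.  In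
  the derivative the \<open>z'\<^sup>2\<close> and \<open>z z'\<close> terms cancel when \<open>z'' = - Q z\<close>, leaving
  \<open>(2 c' Q + c Q' + c''' / 2) z\<^sup>2\<close>.
\<close>

lemma energy_form_deriv:
  fixes p p1 p2 z z1 :: "real \<Rightarrow> real"
  assumes W: "1 - D * t\<^sup>2 \<noteq> 0" and \<rho>: "\<rho> \<noteq> 0"
    and p: "(p has_real_derivative p1 t) (at t)" "(p1 has_real_derivative p2 t) (at t)"
      "(p2 has_real_derivative p3) (at t)"
    and z: "(z has_real_derivative z1 t) (at t)"
      "(z1 has_real_derivative - ((1 - t\<^sup>2) / (\<rho> * (1 - D * t\<^sup>2)\<^sup>2)) * z t) (at t)"
  shows "((\<lambda>t. energy_form \<rho> D t (p t) (p1 t) (p2 t) (z t) (z1 t)) has_real_derivative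
           (t * p t - (1 - t\<^sup>2) * p1 t - (\<rho> / 4) * ((1 - D * t\<^sup>2)
              * ((1 - D * t\<^sup>2) * p3 - 6 * D * t * p2 t - 6 * D * p1 t)))
           * ((z t)\<^sup>2 / (1 - D * t\<^sup>2))) (at t)"
proof -
  define w where "w = (\<lambda>t::real. 1 - D * t\<^sup>2)"
  define s where "s = (\<lambda>t::real. 1 - t\<^sup>2)"
  have w: "(w has_real_derivative - 2 * D * t) (at t)" "w t \<noteq> 0"
    using W unfolding w_def by (auto intro!: derivative_eq_intros)
  have s: "(s has_real_derivative - 2 * t) (at t)"
    unfolding s_def by (auto intro!: derivative_eq_intros)
  have z': "(z1 has_real_derivative - (s t / (\<rho> * (w t)\<^sup>2)) * z t) (at t)"
    using z(2) by (simp add: w_def s_def)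
  define C0 where "C0 = (\<lambda>t. w t * p t)"
  define C1 where "C1 = (\<lambda>t. w t * p1 t - 2 * D * t * p t)"
  define C2 where "C2 = (\<lambda>t. w t * p2 t - 4 * D * t * p1 t - 2 * D * p t)"
  define C3 where "C3 = w t * p3 - 6 * D * t * p2 t - 6 * D * p1 t"
  define Q where "Q = s t / (\<rho> * (w t)\<^sup>2)"
  define K where "K = (\<lambda>t. s t * p t / (2 * w t))"
  define K' where "K' = - (\<rho> / 2) * C1 t * Q - (t * p t - s t * p1 t) / w t"
  have C: "(C0 has_real_derivative C1 t) (at t)" "(C1 has_real_derivative C2 t) (at t)"
    "(C2 has_real_derivative C3) (at t)"
    unfolding C0_def C1_def C2_def C3_def
    by (rule derivative_eq_intros w(1) p refl | simp add: algebra_simps)+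
  have K: "(K has_real_derivative K') (at t)"
  proof -
    have "(K has_real_derivative ((- 2 * t * p t + p1 t * s t) * (2 * w t)
              - s t * p t * (2 * (- 2 * D * t))) / ((2 * w t) * (2 * w t))) (at t)"
      unfolding K_def using w(2)
      by (intro DERIV_divide DERIV_mult DERIV_cmult w(1) s p(1)) auto
    moreover have "((- 2 * t * p t + p1 t * s t) * (2 * w t)
              - s t * p t * (2 * (- 2 * D * t))) / ((2 * w t) * (2 * w t)) = K'"
      unfolding K'_def C1_def Q_def using w(2) \<rho>
      by (simp add: field_simps power2_eq_square)
    ultimately show ?thesis by simp
  qed
  have zz: "(z1 has_real_derivative - Q * z t) (at t)"
    using z' unfolding Q_def .
  have eq: "(\<lambda>t. energy_form \<rho> D t (p t) (p1 t) (p2 t) (z t) (z1 t))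
     = (\<lambda>t. - (\<rho> / 2) * (C0 t * (z1 t * z1 t)) + (\<rho> / 2) * (C1 t * (z t * z1 t))
         - (K t + (\<rho> / 4) * C2 t) * (z t * z t))"
    unfolding energy_form_def w_def s_def C0_def C1_def C2_def K_def
    by (simp add: power2_eq_square mult.assoc)
  have CK: "\<rho> * C0 t * Q = 2 * K t"
    unfolding C0_def Q_def K_def using w(2) \<rho> by (simp add: field_simps power2_eq_square)
  have "((\<lambda>t. energy_form \<rho> D t (p t) (p1 t) (p2 t) (z t) (z1 t)) has_real_derivative
      (\<rho> * C0 t * Q - 2 * K t) * (z t * z1 t)
      + (- (\<rho> / 2) * C1 t * Q - K' - (\<rho> / 4) * C3) * (z t)\<^sup>2) (at t)"
    unfolding eq
    by (rule derivative_eq_intros C K z(1) zz refl)+ (simp add: power2_eq_square algebra_simps)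
  also have "(\<rho> * C0 t * Q - 2 * K t) * (z t * z1 t)
      + (- (\<rho> / 2) * C1 t * Q - K' - (\<rho> / 4) * C3) * (z t)\<^sup>2
      = (t * p t - s t * p1 t - (\<rho> / 4) * (w t * C3)) * ((z t)\<^sup>2 / w t)"
    unfolding CK K'_def using w(2) by (simp add: field_simps)
  finally show ?thesis by (simp add: w_def s_def C3_def)
qed

lemma binary_quadratic_form_nonneg:
  fixes A B C x y :: real
  assumes "A > 0" "B\<^sup>2 \<le> 4 * A * C"
  shows "0 \<le> A * x\<^sup>2 + B * (y * x) + C * y\<^sup>2"
proof -
  have "4 * A * (A * x\<^sup>2 + B * (y * x) + C * y\<^sup>2) = (2 * A * x + B * y)\<^sup>2 + (4 * A * C - B\<^sup>2) * y\<^sup>2"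
    by (simp add: power2_eq_square algebra_simps)
  also have "\<dots> \<ge> 0" using assms by (intro add_nonneg_nonneg mult_nonneg_nonneg) auto
  finally show ?thesis using assms(1) by (simp add: zero_le_mult_iff)
qed

text \<open>
  The discriminant condition, multiplied by \<open>4 / \<rho>\<^sup>2\<close>, reads
  \<open>w\<^sup>2 e1\<^sup>2 + 4 D t w e e1 + 4 D e\<^sup>2 \<le> 4 (1 - t\<^sup>2) e\<^sup>2 / \<rho> + 2 w\<^sup>2 e e2\<close> with \<open>w = 1 - D t\<^sup>2\<close>.  As \<open>D\<close>,
  \<open>t\<close> and \<open>w\<close> lie between 0 and 1, the left-hand side is at most \<open>(e1 + 2 e)\<^sup>2\<close>, which gives a
  condition independent of \<open>D\<close>.
\<close>

lemma energy_form_nonneg: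
  fixes e e1 e2 :: real
  assumes \<rho>: "\<rho> > 0" and D: "0 \<le> D" "D \<le> 1" and t: "0 \<le> t" "t < 1"
    and e: "e > 0" "0 \<le> e1" "0 \<le> e2"
    and bound: "(e1 + 2 * e)\<^sup>2 \<le> 4 * (1 - t\<^sup>2) * e\<^sup>2 / \<rho>"
  shows "0 \<le> energy_form \<rho> D t (- e) (- e1) (- e2) z z1"
proof -
  define w where "w = 1 - D * t\<^sup>2"
  have "D * t\<^sup>2 \<le> 1 * t\<^sup>2" using D by (intro mult_right_mono) auto
  moreover have t2: "t\<^sup>2 < 1" using t by (simp add: power_less_one_iff)
  ultimately have w: "0 < w" "w \<le> 1" using D t by (auto simp: w_def)
  have sq: "w\<^sup>2 * e1\<^sup>2 + 4 * D * t * w * e * e1 + 4 * D * e\<^sup>2 \<le> (e1 + 2 * e)\<^sup>2"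
  proof -
    have "w\<^sup>2 * e1\<^sup>2 \<le> 1 * e1\<^sup>2" using w by (intro mult_right_mono power_le_one) auto
    moreover have "D * t * w \<le> 1 * 1 * 1" using D t w by (intro mult_mono) auto
    then have "D * t * w * (e * e1) \<le> 1 * (e * e1)" using e by (intro mult_right_mono) auto
    moreover have "D * e\<^sup>2 \<le> 1 * e\<^sup>2" using D by (intro mult_right_mono) auto
    ultimately show ?thesis by (simp add: power2_eq_square algebra_simps)
  qed
  have key: "w\<^sup>2 * e1\<^sup>2 + 4 * D * t * w * e * e1 + 4 * D * e\<^sup>2 \<le> 4 * (1 - t\<^sup>2) * e\<^sup>2 / \<rho> + 2 * w\<^sup>2 * e * e2"
  proof -
    have "0 \<le> 2 * w\<^sup>2 * e * e2" using e by (intro mult_nonneg_nonneg) auto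
    then show ?thesis using bound sq by linarith
  qed
  define B where "B = w * e1 - 2 * D * t * e"
  define Y where "Y = w * e2 - 4 * D * t * e1 - 2 * D * e"
  define C where "C = (1 - t\<^sup>2) * e / (2 * w) + (\<rho> / 4) * Y"
  have "B\<^sup>2 \<le> 4 * (1 - t\<^sup>2) * e\<^sup>2 / \<rho> + 2 * w * e * Y"
  proof -
    have "B\<^sup>2 - 2 * w * e * Y + 2 * w\<^sup>2 * e * e2
        = w\<^sup>2 * e1\<^sup>2 + 4 * D * t * w * e * e1 + 4 * D * e\<^sup>2 * (w + D * t\<^sup>2)"
      by (simp add: B_def Y_def power2_eq_square algebra_simps)
    also have "w + D * t\<^sup>2 = 1" by (simp add: w_def)
    finally show ?thesis using key by simp
  qed
  then have "(\<rho> / 2)\<^sup>2 * B\<^sup>2 \<le> (\<rho> / 2)\<^sup>2 * (4 * (1 - t\<^sup>2) * e\<^sup>2 / \<rho> + 2 * w * e * Y)"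
    by (intro mult_left_mono) auto
  also have "\<dots> = 4 * (\<rho> / 2 * (w * e)) * C"
  proof -
    have "(\<rho> / 2)\<^sup>2 * (4 * S * e\<^sup>2 / \<rho> + 2 * w * e * Y)
        = 4 * (\<rho> / 2 * (w * e)) * (S * e / (2 * w) + (\<rho> / 4) * Y)" for S
      using w(1) \<rho> by (simp add: field_simps power2_eq_square)
    then show ?thesis unfolding C_def .
  qed
  finally have disc: "(- (\<rho> / 2 * B))\<^sup>2 \<le> 4 * (\<rho> / 2 * (w * e)) * C" by (simp add: power_mult_distrib power_divide)
  define S where "S = 1 - t\<^sup>2"
  have "0 \<le> (\<rho> / 2 * (w * e)) * z1\<^sup>2 + (- (\<rho> / 2 * B)) * (z * z1) + C * z\<^sup>2"
    by (rule binary_quadratic_form_nonneg) (use disc w e \<rho> in auto)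
  also have "\<dots> = energy_form \<rho> D t (- e) (- e1) (- e2) z z1"
    unfolding energy_form_def w_def[symmetric] B_def C_def Y_def S_def[symmetric]
    by (simp add: algebra_simps)
  finally show ?thesis .
qed

section \<open>The comparison function\<close>

text \<open>
  In terms of the angle this is \<open>((1 - \<rho>) * \<theta> - \<kappa>) / sin \<theta> + \<nu> / sin \<theta> ^ 7\<close>.
\<close>

definition comparison :: "real \<Rightarrow> real \<Rightarrow> real \<Rightarrow> real \<Rightarrow> real" where
  "comparison \<rho> \<kappa> \<nu> t = (1 - \<rho>) * angle_ratio t - \<kappa> * inv_sin t + \<nu> * inv_sin t ^ 7"

definition comparison1 :: "real \<Rightarrow> real \<Rightarrow> real \<Rightarrow> real \<Rightarrow> real" where
  "comparison1 \<rho> \<kappa> \<nu> t = (1 - \<rho>) * angle_ratio1 t - \<kappa> * (t * inv_sin t ^ 3)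
     + \<nu> * (7 * t * inv_sin t ^ 9)"

definition comparison2 :: "real \<Rightarrow> real \<Rightarrow> real \<Rightarrow> real \<Rightarrow> real" where
  "comparison2 \<rho> \<kappa> \<nu> t = (1 - \<rho>) * angle_ratio2 t
     - \<kappa> * (inv_sin t ^ 3 + 3 * t\<^sup>2 * inv_sin t ^ 5)
     + \<nu> * (7 * inv_sin t ^ 9 + 63 * t\<^sup>2 * inv_sin t ^ 11)"

definition comparison3 :: "real \<Rightarrow> real \<Rightarrow> real \<Rightarrow> real \<Rightarrow> real" where
  "comparison3 \<rho> \<kappa> \<nu> t = (1 - \<rho>) * angle_ratio3 t
     - \<kappa> * (9 * t * inv_sin t ^ 5 + 15 * t ^ 3 * inv_sin t ^ 7)
     + \<nu> * (189 * t * inv_sin t ^ 11 + 693 * t ^ 3 * inv_sin t ^ 13)"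

lemma comparison_derivs:
  assumes "-1 < t" "t < 1"
  shows "(comparison \<rho> \<kappa> \<nu> has_real_derivative comparison1 \<rho> \<kappa> \<nu> t) (at t)"
    and "(comparison1 \<rho> \<kappa> \<nu> has_real_derivative comparison2 \<rho> \<kappa> \<nu> t) (at t)"
    and "(comparison2 \<rho> \<kappa> \<nu> has_real_derivative comparison3 \<rho> \<kappa> \<nu> t) (at t)"
proof -
  note g = inv_sin_deriv[OF assms] inv_sin_power_deriv[OF assms] and f = angle_ratio_derivs[OF assms]
  show "(comparison \<rho> \<kappa> \<nu> has_real_derivative comparison1 \<rho> \<kappa> \<nu> t) (at t)"
    unfolding comparison_def[abs_def] comparison1_def
    apply (rule DERIV_cong)
     apply (rule DERIV_add DERIV_diff DERIV_cmult g f)+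
    by (simp add: mult_ac)
  show "(comparison1 \<rho> \<kappa> \<nu> has_real_derivative comparison2 \<rho> \<kappa> \<nu> t) (at t)"
    unfolding comparison1_def[abs_def] comparison2_def
    apply (rule DERIV_cong)
     apply (rule DERIV_add DERIV_diff DERIV_cmult DERIV_mult DERIV_ident DERIV_const g f)+
    by (simp add: algebra_simps power2_eq_square)
  show "(comparison2 \<rho> \<kappa> \<nu> has_real_derivative comparison3 \<rho> \<kappa> \<nu> t) (at t)"
    unfolding comparison2_def[abs_def] comparison3_def
    apply (rule DERIV_cong)
     apply (rule DERIV_add DERIV_diff DERIV_cmult DERIV_mult DERIV_pow DERIV_ident DERIV_const g f)+
    by (simp add: algebra_simps power2_eq_square power3_eq_cube)
qed

text \<open>
  Since \<open>t f - (1 - t\<^sup>2) f' = 1\<close> for \<open>f t = \<theta> / sin \<theta>\<close>, and \<open>= 0\<close> for \<open>1 / sin \<theta>\<close>, the first-order part is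
  \<open>1 - \<rho> - 6 * \<nu> * t / sin \<theta> ^ 7\<close>.  The deficit \<open>\<rho>\<close> pays for the third-order part of \<open>f\<close>, which is at least
  \<open>- 4\<close>.  The deficit with \<open>\<nu>\<close> pays for that of \<open>\<kappa> / sin \<theta>\<close>, which is at most \<open>15 * \<kappa> * t / sin \<theta> ^ 7\<close>; this
  fixes \<open>\<nu> = 5/8 * \<kappa> * \<rho>\<close>.  The third-order part of \<open>1 / sin \<theta> ^ 7\<close> has the favourable sign.
\<close>

lemma comparison_inequality:
  assumes D: "0 \<le> D" "D \<le> 1" and \<rho>: "0 \<le> \<rho>" "\<rho> \<le> 1" and \<kappa>: "0 \<le> \<kappa>"
    and t: "0 \<le> t" "t < 1"
  defines "\<nu> \<equiv> 5 / 8 * \<kappa> * \<rho>" and "w \<equiv> 1 - D * t\<^sup>2"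
  shows "t * comparison \<rho> \<kappa> \<nu> t - (1 - t\<^sup>2) * comparison1 \<rho> \<kappa> \<nu> t
     - (\<rho> / 4) * (w * (w * comparison3 \<rho> \<kappa> \<nu> t - 6 * D * t * comparison2 \<rho> \<kappa> \<nu> t
                          - 6 * D * comparison1 \<rho> \<kappa> \<nu> t)) \<le> 1"
proof -
  let ?g = "inv_sin t"
  define s where "s = 1 - t\<^sup>2"
  have t': "-1 < t" using t by simp
  have g: "?g > 0" by (rule inv_sin_pos[OF t' t(2)])
  have sg: "s * ?g\<^sup>2 = 1" unfolding s_def by (rule inv_sin_sq[OF t' t(2)])
  have t2: "0 \<le> t\<^sup>2" "t\<^sup>2 < 1" using t by (auto simp: power_less_one_iff)
  have Dt: "D * t\<^sup>2 \<le> 1 * t\<^sup>2" using D by (intro mult_right_mono) auto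
  have w: "s \<le> w" "w \<le> 1" "0 < w" "0 < s" using D t2 Dt by (auto simp: w_def s_def)
  have \<nu>: "0 \<le> \<nu>" unfolding \<nu>_def using \<kappa> \<rho> by simp
  have sgn: "s * ?g ^ (n + 2) = ?g ^ n" for n
    using sg by (simp add: power_add power2_eq_square mult.left_commute)
  have first: "t * comparison \<rho> \<kappa> \<nu> t - s * comparison1 \<rho> \<kappa> \<nu> t = (1 - \<rho>) - 6 * \<nu> * (t * ?g ^ 7)"
  proof -
    have a: "s * angle_ratio1 t = t * angle_ratio t - 1"
      unfolding angle_ratio1_def using sg by (simp add: mult.left_commute)
    have "t * comparison \<rho> \<kappa> \<nu> t - s * comparison1 \<rho> \<kappa> \<nu> t
       = (1 - \<rho>) * (t * angle_ratio t - s * angle_ratio1 t) - \<kappa> * t * (?g - s * ?g ^ (1 + 2))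
         + \<nu> * t * (?g ^ 7 - 7 * (s * ?g ^ (7 + 2)))"
      unfolding comparison_def comparison1_def by (simp add: algebra_simps power3_eq_cube)
    also have "\<dots> = (1 - \<rho>) - 6 * \<nu> * (t * ?g ^ 7)" unfolding a sgn by simp
    finally show ?thesis .
  qed
  define Bf where "Bf = w * (w * angle_ratio3 t - 6 * D * t * angle_ratio2 t - 6 * D * angle_ratio1 t)"
  define Bg where "Bg = w * (w * (9 * t * ?g ^ 5 + 15 * t ^ 3 * ?g ^ 7)
      - 6 * D * t * (?g ^ 3 + 3 * t\<^sup>2 * ?g ^ 5) - 6 * D * (t * ?g ^ 3))"
  define Bh where "Bh = w * (w * (189 * t * ?g ^ 11 + 693 * t ^ 3 * ?g ^ 13)
      - 6 * D * t * (7 * ?g ^ 9 + 63 * t\<^sup>2 * ?g ^ 11) - 6 * D * (7 * t * ?g ^ 9))"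
  have split: "w * (w * comparison3 \<rho> \<kappa> \<nu> t - 6 * D * t * comparison2 \<rho> \<kappa> \<nu> t
                          - 6 * D * comparison1 \<rho> \<kappa> \<nu> t) = (1 - \<rho>) * Bf - \<kappa> * Bg + \<nu> * Bh"
    unfolding comparison3_def comparison2_def comparison1_def Bf_def Bg_def Bh_def
    by (simp add: algebra_simps)
  note fb = angle_ratio_bounds[OF t]
  have Bf: "Bf \<ge> - 4"
  proof -
    have "D * (t * angle_ratio2 t + angle_ratio1 t) \<le> 0"
      using fb(4) D by (simp add: mult_nonneg_nonpos)
    then have "w * (w * angle_ratio3 t) \<le> Bf"
      unfolding Bf_def using w by (intro mult_left_mono) (auto simp: algebra_simps)
    moreover have "(w * w) * (- 4) \<le> (w * w) * angle_ratio3 t"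
      using fb(3) w by (intro mult_left_mono) auto
    moreover have "w * w \<le> 1" using w by (simp add: mult_le_one)
    ultimately show ?thesis by (simp add: mult.assoc)
  qed
  have Bg: "Bg \<le> 15 * (t * ?g ^ 7)"
  proof -
    have "0 \<le> 6 * D * t * (?g ^ 3 + 3 * t\<^sup>2 * ?g ^ 5)" "0 \<le> 6 * D * (t * ?g ^ 3)"
      using D t g by (auto intro!: mult_nonneg_nonneg add_nonneg_nonneg)
    then have "Bg \<le> w * (w * (9 * t * ?g ^ 5 + 15 * t ^ 3 * ?g ^ 7))"
      unfolding Bg_def using w by (intro mult_left_mono) auto
    also have "\<dots> = (w * w) * (t * ?g ^ 7 * (9 * s + 15 * t\<^sup>2))"
      unfolding sgn[of 5, simplified, symmetric] by (simp add: algebra_simps power2_eq_square power3_eq_cube)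
    also have "\<dots> \<le> 1 * (t * ?g ^ 7 * (9 * s + 15 * t\<^sup>2))"
      using w t g t2 by (intro mult_right_mono mult_nonneg_nonneg) (auto simp: mult_le_one)
    also have "\<dots> \<le> t * ?g ^ 7 * 15"
      unfolding mult_1 using w t g by (intro mult_left_mono) (auto simp: s_def)
    finally show ?thesis by simp
  qed
  have Bh: "0 \<le> Bh"
  proof -
    have "s * (189 * t * ?g ^ 11 + 693 * t ^ 3 * ?g ^ 13)
        = 189 * t * (s * ?g ^ (9 + 2)) + 693 * t ^ 3 * (s * ?g ^ (11 + 2))" by (simp add: algebra_simps)
    also have "\<dots> = 189 * (t * ?g ^ 9) + 693 * (t ^ 3 * ?g ^ 11)" unfolding sgn by simp
    finally have e: "s * (189 * t * ?g ^ 11 + 693 * t ^ 3 * ?g ^ 13)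
        = 189 * (t * ?g ^ 9) + 693 * (t ^ 3 * ?g ^ 11)" .
    have p: "0 \<le> t * ?g ^ 9" "0 \<le> t ^ 3 * ?g ^ 11" using t g by auto
    have "D * (t * ?g ^ 9) \<le> 1 * (t * ?g ^ 9)" "D * (t ^ 3 * ?g ^ 11) \<le> 1 * (t ^ 3 * ?g ^ 11)"
      by (rule mult_right_mono[OF D(2) p(1)], rule mult_right_mono[OF D(2) p(2)])
    then have "6 * D * t * (7 * ?g ^ 9 + 63 * t\<^sup>2 * ?g ^ 11) + 6 * D * (7 * t * ?g ^ 9)
       \<le> s * (189 * t * ?g ^ 11 + 693 * t ^ 3 * ?g ^ 13)"
      unfolding e using p by (simp add: algebra_simps power2_eq_square power3_eq_cube)
    also have "\<dots> \<le> w * (189 * t * ?g ^ 11 + 693 * t ^ 3 * ?g ^ 13)"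
      using w t g by (intro mult_right_mono) auto
    finally show ?thesis unfolding Bh_def using w by simp
  qed
  have "(1 - \<rho>) * (- 4) \<le> (1 - \<rho>) * Bf" using Bf \<rho> by (intro mult_left_mono) auto
  moreover have "\<kappa> * Bg \<le> \<kappa> * (15 * (t * ?g ^ 7))" using Bg \<kappa> by (intro mult_left_mono) auto
  moreover have "0 \<le> \<nu> * Bh" using Bh \<nu> by simp
  ultimately have "- 4 * (1 - \<rho>) - 15 * \<kappa> * (t * ?g ^ 7) \<le> (1 - \<rho>) * Bf - \<kappa> * Bg + \<nu> * Bh" by simp
  then have "(\<rho> / 4) * (- 4 * (1 - \<rho>) - 15 * \<kappa> * (t * ?g ^ 7))
       \<le> (\<rho> / 4) * ((1 - \<rho>) * Bf - \<kappa> * Bg + \<nu> * Bh)" (is "_ \<le> ?R")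
    using \<rho> by (intro mult_left_mono) auto
  moreover have "(\<rho> / 4) * (- 4 * (1 - \<rho>) - 15 * \<kappa> * (t * ?g ^ 7))
      = - (\<rho> * (1 - \<rho>)) - 6 * \<nu> * (t * ?g ^ 7)"
    unfolding \<nu>_def by (simp add: algebra_simps)
  moreover have "\<rho> * (1 - \<rho>) \<le> \<rho>" using \<rho> by (simp add: mult_left_le)
  ultimately have "(1 - \<rho>) - 6 * \<nu> * (t * ?g ^ 7) - ?R \<le> 1" by linarith
  then show ?thesis unfolding s_def[symmetric] first split .
qed

lemma sin_ge_cubic:
  fixes x :: real
  assumes "0 \<le> x"
  shows "x - x ^ 3 / 6 \<le> sin x"
proof -
  have "\<bar>sin x - (\<Sum>m<3. sin_coeff m * x ^ m)\<bar> \<le> inverse (fact 3) * \<bar>x\<bar> ^ 3"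
    by (rule Maclaurin_sin_bound)
  then have "\<bar>sin x - x\<bar> \<le> x ^ 3 / 6" using assms by (simp add: eval_nat_numeral sin_coeff_def)
  then show ?thesis by linarith
qed

lemma cos_le_quartic:
  fixes x :: real
  shows "cos x \<le> 1 - x\<^sup>2 / 2 + x ^ 4 / 24"
proof -
  obtain t where "cos x = (\<Sum>m<4. cos_coeff m * x ^ m) + cos (t + 1/2 * real 4 * pi) / fact 4 * x ^ 4"
    using Maclaurin_cos_expansion[of x 4] by blast
  moreover have "(\<Sum>m<4. f m) = f 0 + f 1 + f 2 + f 3" for f :: "nat \<Rightarrow> real"
    by (simp add: eval_nat_numeral)
  moreover have "cos_coeff 0 = 1" "cos_coeff 1 = 0" "cos_coeff 2 = - 1 / 2" "cos_coeff 3 = 0"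
    by (simp_all add: cos_coeff_def)
  ultimately have "cos x = 1 - x\<^sup>2 / 2 + cos (t + 2 * pi) / 24 * x ^ 4"
    by (simp add: fact_numeral)
  moreover have "cos (t + 2 * pi) / 24 * x ^ 4 \<le> 1 / 24 * x ^ 4"
    by (intro mult_right_mono divide_right_mono) auto
  ultimately show ?thesis by simp
qed

lemma cos_ge_quadratic:
  fixes x :: real
  shows "1 - x\<^sup>2 / 2 \<le> cos x"
proof -
  obtain t where "cos x = (\<Sum>m<2. cos_coeff m * x ^ m) + cos (t + 1/2 * real 2 * pi) / fact 2 * x ^ 2"
    using Maclaurin_cos_expansion[of x 2] by blast
  then have "cos x = 1 + cos (t + pi) / 2 * x\<^sup>2"
    by (simp add: eval_nat_numeral cos_coeff_def)
  moreover have "(- 1 / 2) * x\<^sup>2 \<le> cos (t + pi) / 2 * x\<^sup>2"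
    by (intro mult_right_mono) auto
  ultimately show ?thesis by simp
qed

text \<open>
  At the angle \<open>48/25 * r\<close> all quantities scale with powers of \<open>r\<close>.  With \<open>\<gamma> = r / sin \<theta>\<close>, which is at
  most \<open>50/81\<close>, each claim becomes a numerical inequality in \<open>\<gamma>\<close> and \<open>1 / r\<^sup>2 \<ge> 4\<close>.  The number \<open>42/25\<close>
  is an upper bound for \<open>4 * 2 powr (1/3) / 3\<close>, so that the last claim places \<open>t\<close> inside the cutoff.
\<close>

lemma comparison_boundary:
  fixes r :: real
  assumes r: "0 < r" "r \<le> 1/2"
  defines "\<rho> \<equiv> r ^ 6" and "\<kappa> \<equiv> 49/20 * r" and "t \<equiv> cos (48/25 * r)"
  defines "\<nu> \<equiv> 5/8 * \<kappa> * \<rho>"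
  defines "e \<equiv> - comparison \<rho> \<kappa> \<nu> t" and "e1 \<equiv> - comparison1 \<rho> \<kappa> \<nu> t"
    and "e2 \<equiv> - comparison2 \<rho> \<kappa> \<nu> t"
  shows "0 < e" "0 \<le> e1" "0 \<le> e2" "(e1 + 2 * e)\<^sup>2 \<le> 4 * (1 - t\<^sup>2) * e\<^sup>2 / \<rho>"
    and "1/2 \<le> t" "t < 1" "t \<le> 1 - 42/25 * r\<^sup>2"
proof -
  define \<theta> where "\<theta> = 48/25 * r"
  have \<theta>: "0 < \<theta>" "\<theta> \<le> 24/25" "\<theta> < pi" using r pi_gt3 by (auto simp: \<theta>_def)
  have r2: "0 < r\<^sup>2" "r\<^sup>2 \<le> 1/4" using r power_mono[of r "1/2" 2] by (auto simp: power2_eq_square)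
  have tc: "t = cos \<theta>" by (simp add: t_def \<theta>_def)
  have "\<theta>\<^sup>2 \<le> (24/25)\<^sup>2" using \<theta> by (intro power_mono) auto
  then have "539/1000 \<le> t" using cos_ge_quadratic[of \<theta>] unfolding tc by (simp add: power2_eq_square)
  then have t_ge: "539/1000 \<le> t" .
  then show "1/2 \<le> t" by simp
  have t1: "t < 1" unfolding tc using cos_monotone_0_pi[of 0 \<theta>] \<theta> by simp
  then show "t < 1" .
  show "t \<le> 1 - 42/25 * r\<^sup>2"
  proof -
    have "r ^ 4 = r\<^sup>2 * r\<^sup>2" by (simp add: power2_eq_square power4_eq_xxxx)
    also have "\<dots> \<le> 1/4 * r\<^sup>2" using r2 by (intro mult_right_mono) auto
    finally have "r ^ 4 \<le> 1/4 * r\<^sup>2" .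
    moreover have "cos \<theta> \<le> 1 - 1152/625 * r\<^sup>2 + 221184/390625 * r ^ 4"
      using cos_le_quartic[of \<theta>] unfolding \<theta>_def by (simp add: power_mult_distrib power_divide)
    ultimately show ?thesis using r2 unfolding tc by linarith
  qed
  have arc: "arccos t = \<theta>" unfolding tc using \<theta> by (intro arccos_cos) auto
  define s where "s = sin \<theta>"
  \<comment> \<open>The factor is \<open>48/25 * (1 - (24/25)\<^sup>2 / 6) > 1.62\<close>.\<close>
  have s_ge: "81/50 * r \<le> s"
  proof -
    have "\<theta> ^ 3 = \<theta>\<^sup>2 * \<theta>" by (simp add: power2_eq_square power3_eq_cube)
    also have "\<dots> \<le> (24/25)\<^sup>2 * \<theta>" using \<theta> by (intro mult_right_mono power_mono) auto
    finally show ?thesis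
      using sin_ge_cubic[of \<theta>] \<theta> r unfolding s_def by (simp add: \<theta>_def power2_eq_square)
  qed
  then have s: "0 < s" "s \<le> 1" using r by (auto simp: s_def intro: less_le_trans[of 0 "81/50 * r"])
  define g where "g = inv_sin t"
  have g: "g = 1 / s" unfolding g_def tc s_def by (rule inv_sin_cos[OF \<theta>(1,3)])
  have g1: "1 \<le> g" "0 < g" using s unfolding g by auto
  define \<gamma> where "\<gamma> = r * g"
  have \<gamma>: "0 < \<gamma>" "\<gamma> \<le> 50/81"
    using s_ge s r unfolding \<gamma>_def g by (auto simp: field_simps)
  have \<gamma>3: "0 < \<gamma> ^ 3" "\<gamma> ^ 3 \<le> 2353/10000"
    using \<gamma> power_mono[of \<gamma> "50/81" 3] by (auto simp: power3_eq_cube)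
  have \<gamma>6: "0 < \<gamma> ^ 6" "\<gamma> ^ 6 \<le> 554/10000"
    using \<gamma> power_mono[of \<gamma> "50/81" 6] by (auto simp: eval_nat_numeral)
  have \<rho>: "0 < \<rho>" "\<rho> \<le> 1"
    using r power_le_one[of r 6] by (auto simp: \<rho>_def)
  have \<kappa>: "0 < \<kappa>" using r by (simp add: \<kappa>_def)
  have \<nu>g: "\<nu> * g ^ 6 = 5/8 * \<kappa> * \<gamma> ^ 6" by (simp add: \<nu>_def \<gamma>_def \<rho>_def power_mult_distrib)
  have t0: "0 \<le> t" using t_ge by simp
  note fb = angle_ratio_bounds[OF t0 t1, folded g_def]
  have e_eq: "e = \<gamma> * (49/20 - 48/25 * (1 - \<rho>) - 49/32 * \<gamma> ^ 6)"
  proof -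
    have "e = g * (\<kappa> - (1 - \<rho>) * \<theta> - \<nu> * g ^ 6)"
      unfolding e_def comparison_def angle_ratio_def arc g_def[symmetric]
      by (simp add: right_diff_distrib eval_nat_numeral)
    also have "\<dots> = g * (\<kappa> - (1 - \<rho>) * \<theta> - 5/8 * \<kappa> * \<gamma> ^ 6)" unfolding \<nu>g ..
    finally show ?thesis by (simp add: \<kappa>_def \<theta>_def \<gamma>_def algebra_simps)
  qed
  have e_ge: "89/200 * \<gamma> \<le> e"
  proof -
    have "89/200 \<le> 49/20 - 48/25 * (1 - \<rho>) - 49/32 * \<gamma> ^ 6" using \<gamma>6(2) \<rho>(1) by (simp add: field_simps)
    then have "\<gamma> * (89/200) \<le> e" unfolding e_eq using \<gamma> by (intro mult_left_mono) auto
    then show ?thesis by simp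
  qed
  moreover have "0 < 89/200 * \<gamma>" using \<gamma> by simp
  ultimately show e_pos: "0 < e" by (rule less_le_trans[rotated])
  have e1_eq: "e1 = (1 - \<rho>) * (- angle_ratio1 t) + \<kappa> * t * g ^ 3 * (1 - 35/8 * \<gamma> ^ 6)"
  proof -
    have "e1 = (1 - \<rho>) * (- angle_ratio1 t) + t * g ^ 3 * (\<kappa> - 7 * (\<nu> * g ^ 6))"
      unfolding e1_def comparison1_def g_def[symmetric]
      by (simp add: algebra_simps eval_nat_numeral)
    then show ?thesis unfolding \<nu>g by (simp add: algebra_simps)
  qed
  show e1_nonneg: "0 \<le> e1"
    unfolding e1_eq using fb(1) \<rho> \<kappa> t0 g1 \<gamma>6
    by (intro add_nonneg_nonneg mult_nonneg_nonneg) auto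
  have \<kappa>g: "\<kappa> * g ^ 3 = 49/20 * \<gamma> ^ 3 / r\<^sup>2"
    using r by (simp add: \<kappa>_def \<gamma>_def power_mult_distrib power2_eq_square power3_eq_cube)
  have e1_le: "e1 \<le> (48/25 * \<gamma>) ^ 3 / 3 + 49/20 * \<gamma> ^ 3 / r\<^sup>2"
  proof -
    have "(1 - \<rho>) * (- angle_ratio1 t) \<le> 1 * (- angle_ratio1 t)"
      using \<rho> fb(1) by (intro mult_right_mono) auto
    also have "\<dots> \<le> (\<theta> * g) ^ 3 / 3" using fb(5) arc by simp
    also have "\<theta> * g = 48/25 * \<gamma>" by (simp add: \<theta>_def \<gamma>_def)
    finally have "(1 - \<rho>) * (- angle_ratio1 t) \<le> (48/25 * \<gamma>) ^ 3 / 3" .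
    moreover have "(\<kappa> * g ^ 3) * (t * (1 - 35/8 * \<gamma> ^ 6)) \<le> (\<kappa> * g ^ 3) * (1 * 1)"
      using \<kappa> g1 t0 t1 \<gamma>6 by (intro mult_left_mono mult_mono) auto
    moreover have "\<kappa> * t * g ^ 3 * (1 - 35/8 * \<gamma> ^ 6) = (\<kappa> * g ^ 3) * (t * (1 - 35/8 * \<gamma> ^ 6))"
      by (simp only: mult_ac)
    ultimately show ?thesis unfolding e1_eq \<kappa>g[symmetric] by linarith
  qed
  show "0 \<le> e2"
  proof -
    have "e2 = - ((1 - \<rho>) * angle_ratio2 t) + g ^ 3 * (\<kappa> - 7 * (\<nu> * g ^ 6))
        + 3 * t\<^sup>2 * g ^ 5 * (\<kappa> - 21 * (\<nu> * g ^ 6))"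
      unfolding e2_def comparison2_def g_def[symmetric]
      by (simp add: algebra_simps eval_nat_numeral)
    then have e2: "e2 = - ((1 - \<rho>) * angle_ratio2 t) + g ^ 3 * \<kappa> * (1 - 35/8 * \<gamma> ^ 6)
        + 3 * t\<^sup>2 * g\<^sup>2 * (g ^ 3 * \<kappa>) * (1 - 105/8 * \<gamma> ^ 6)"
      unfolding \<nu>g by (simp add: algebra_simps eval_nat_numeral)
    have "angle_ratio2 t \<le> angle_ratio t * g\<^sup>2"
      unfolding angle_ratio2_def g_def[symmetric] using fb(1) t0
      by (intro mult_right_mono) (auto simp: mult_nonneg_nonpos)
    also have "\<dots> = g ^ 3 * \<kappa> * (192/245)"
      unfolding angle_ratio_def arc g_def[symmetric] \<theta>_def \<kappa>_def by (simp add: power2_eq_square power3_eq_cube)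
    finally have "(1 - \<rho>) * angle_ratio2 t \<le> 1 * (g ^ 3 * \<kappa> * (192/245))"
      using \<rho> fb(2) by (intro mult_mono) auto
    moreover have "g ^ 3 * \<kappa> * (1 - 35/8 * (554/10000)) \<le> g ^ 3 * \<kappa> * (1 - 35/8 * \<gamma> ^ 6)"
      using g1 \<kappa> \<gamma>6 by (intro mult_left_mono) auto
    moreover have "3 * (29/100) * 1 * (g ^ 3 * \<kappa>) * (1 - 105/8 * (554/10000))
        \<le> 3 * t\<^sup>2 * g\<^sup>2 * (g ^ 3 * \<kappa>) * (1 - 105/8 * \<gamma> ^ 6)"
    proof -
      have "(539/1000)\<^sup>2 \<le> t\<^sup>2" using t_ge by (intro power_mono) auto
      then have "29/100 \<le> t\<^sup>2" by (simp add: power2_eq_square)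
      moreover have "1 \<le> g\<^sup>2" using g1 by simp
      ultimately show ?thesis using g1 \<kappa> \<gamma>6 by (intro mult_mono) auto
    qed
    moreover have "0 < g ^ 3 * \<kappa>" using g1 \<kappa> by simp
    ultimately show ?thesis unfolding e2 by (simp add: algebra_simps)
  qed
  \<comment> \<open>Since \<open>sqrt (1 - t\<^sup>2) = r / \<gamma>\<close>, the right-hand side is the square of \<open>2 * e / (\<gamma> * r\<^sup>2)\<close>.\<close>
  have "e1 + 2 * e \<le> 2 * e / (\<gamma> * r\<^sup>2)"
  proof -
    define R where "R = 1 / r\<^sup>2"
    have R: "4 \<le> R" using r2 by (simp add: R_def field_simps)
    have pos: "0 \<le> R / \<gamma> - 1" using R \<gamma> by (simp add: field_simps)
    have "(48/25 * \<gamma>) ^ 3 / 3 + 49/20 * \<gamma> ^ 3 / r\<^sup>2 = \<gamma> ^ 3 * (110592/46875 + 49/20 * R)"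
      by (simp add: R_def power_mult_distrib power3_eq_cube algebra_simps)
    also have "\<dots> \<le> 2353/10000 * (110592/46875 + 49/20 * R)"
      using \<gamma>3 R by (intro mult_right_mono) auto
    also have "\<dots> \<le> 89/100 * R - 89/100 * (50/81)" using R by simp
    also have "\<dots> \<le> 89/100 * R - 89/100 * \<gamma>" using \<gamma> by simp
    also have "\<dots> = 2 * (89/200 * \<gamma>) * (R / \<gamma> - 1)" using \<gamma> by (simp add: field_simps)
    also have "\<dots> \<le> 2 * e * (R / \<gamma> - 1)"
      using e_ge pos by (intro mult_right_mono) auto
    finally have "e1 \<le> 2 * e * (R / \<gamma> - 1)" using e1_le by simp
    then show ?thesis by (simp add: R_def algebra_simps)
  qed
  then have "(e1 + 2 * e)\<^sup>2 \<le> (2 * e / (\<gamma> * r\<^sup>2))\<^sup>2"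
    using e1_nonneg e_pos by (intro power_mono) auto
  also have "\<dots> = 4 * (1 - t\<^sup>2) * e\<^sup>2 / \<rho>"
  proof -
    have "1 - t\<^sup>2 = s\<^sup>2" unfolding tc s_def by (simp add: sin_squared_eq)
    moreover have "2 * e / (\<gamma> * r\<^sup>2) = 2 * e * s / r ^ 3"
      unfolding \<gamma>_def g by (simp add: power2_eq_square power3_eq_cube)
    moreover have "(r ^ 3)\<^sup>2 = \<rho>" by (simp add: \<rho>_def flip: power_mult)
    ultimately show ?thesis by (simp add: power_divide power_mult_distrib)
  qed
  finally show "(e1 + 2 * e)\<^sup>2 \<le> 4 * (1 - t\<^sup>2) * e\<^sup>2 / \<rho>" .
qed

section \<open>Lower bounds for the integral\<close>

lemma integral_ge_of_derivative_le:
  fixes F f h :: "real \<Rightarrow> real"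
  assumes "a \<le> b"
    and F: "\<And>x. \<lbrakk>a \<le> x; x \<le> b\<rbrakk> \<Longrightarrow> (F has_real_derivative f x) (at x)"
    and le: "\<And>x. \<lbrakk>a \<le> x; x \<le> b\<rbrakk> \<Longrightarrow> f x \<le> h x"
    and h: "continuous_on {a..b} h"
  shows "F b - F a \<le> integral {a..b} h"
proof -
  have "(f has_integral (F b - F a)) {a..b}"
    using assms(1)
  proof (rule fundamental_theorem_of_calculus)
    fix x assume "x \<in> {a..b}"
    then show "(F has_vector_derivative f x) (at x within {a..b})"
      using F[of x] by (auto simp: has_real_derivative_iff_has_vector_derivative
          intro: has_vector_derivative_at_within)
  qed
  moreover have "(h has_integral integral {a..b} h) {a..b}"
    using integrable_continuous_interval[OF h] by (rule integrable_integral)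
  ultimately show ?thesis by (rule has_integral_le) (use le in auto)
qed

text \<open>
  The differential equation is scaled so that the turning point is \<open>t = 1\<close>.  The bound is \<open>- F 0\<close> for
  the energy form \<open>F\<close> built from the comparison function, whose value and second derivative at 0
  are \<open>(1 - \<rho>) * (pi / 2) - \<kappa>\<close> up to positive multiples of \<open>\<nu>\<close>.
\<close>

lemma oscillation_integral_ge:
  fixes r D :: real and z z1 :: "real \<Rightarrow> real"
  assumes r: "0 < r" "r \<le> 1/2" and D: "0 \<le> D" "D \<le> 1"
  defines "T \<equiv> cos (48/25 * r)"
  assumes z: "\<And>t. \<lbrakk>0 \<le> t; t < 1\<rbrakk> \<Longrightarrow> (z has_real_derivative z1 t) (at t)"
    and z1: "\<And>t. \<lbrakk>0 \<le> t; t < 1\<rbrakk> \<Longrightarrow>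
        (z1 has_real_derivative - ((1 - t\<^sup>2) / (r ^ 6 * (1 - D * t\<^sup>2)\<^sup>2)) * z t) (at t)"
    and "z1 0 = 0"
  shows "(1 - r ^ 6 / 2) * ((1 - r ^ 6) * (pi / 2) - 49/20 * r) / 2 * (z 0)\<^sup>2
     \<le> integral {0..T} (\<lambda>t. (z t)\<^sup>2 / (1 - D * t\<^sup>2))"
proof -
  define \<rho> where "\<rho> = r ^ 6"
  define \<kappa> where "\<kappa> = 49/20 * r"
  define \<nu> where "\<nu> = 5/8 * \<kappa> * \<rho>"
  have \<rho>: "0 < \<rho>" "\<rho> \<le> 1/64"
    using r power_mono[of r "1/2" 6] by (auto simp: \<rho>_def power_divide)
  have \<kappa>: "0 < \<kappa>" "\<kappa> \<le> 49/40" using r by (auto simp: \<kappa>_def)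
  have \<nu>: "0 < \<nu>" using \<rho> \<kappa> by (simp add: \<nu>_def)
  note bd = comparison_boundary[OF r, folded \<rho>_def \<kappa>_def T_def, folded \<nu>_def]
  have T: "0 \<le> T" "T < 1" using bd(5,6) by auto
  have W: "0 < 1 - D * t\<^sup>2" if "0 \<le> t" "t < 1" for t
  proof -
    have "D * t\<^sup>2 \<le> 1 * t\<^sup>2" using D by (intro mult_right_mono) auto
    moreover have "t\<^sup>2 < 1" using that by (simp add: power_less_one_iff)
    ultimately show ?thesis by simp
  qed
  define F where "F = (\<lambda>t. energy_form \<rho> D t (comparison \<rho> \<kappa> \<nu> t) (comparison1 \<rho> \<kappa> \<nu> t)
      (comparison2 \<rho> \<kappa> \<nu> t) (z t) (z1 t))"
  define f where "f = (\<lambda>t. (t * comparison \<rho> \<kappa> \<nu> t - (1 - t\<^sup>2) * comparison1 \<rho> \<kappa> \<nu> t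
      - (\<rho> / 4) * ((1 - D * t\<^sup>2) * ((1 - D * t\<^sup>2) * comparison3 \<rho> \<kappa> \<nu> t
          - 6 * D * t * comparison2 \<rho> \<kappa> \<nu> t - 6 * D * comparison1 \<rho> \<kappa> \<nu> t)))
      * ((z t)\<^sup>2 / (1 - D * t\<^sup>2)))"
  have "F T - F 0 \<le> integral {0..T} (\<lambda>t. (z t)\<^sup>2 / (1 - D * t\<^sup>2))"
  proof (rule integral_ge_of_derivative_le[where f = f])
    fix t assume t: "0 \<le> t" "t \<le> T"
    then have t': "-1 < t" "t < 1" using T by auto
    have w: "0 < 1 - D * t\<^sup>2" using W t t' by simp
    show "(F has_real_derivative f t) (at t)"
      unfolding F_def f_def
    proof (rule energy_form_deriv[where p = "comparison \<rho> \<kappa> \<nu>" and ?p1.0 = "comparison1 \<rho> \<kappa> \<nu>"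
          and ?p2.0 = "comparison2 \<rho> \<kappa> \<nu>" and z = z and ?z1.0 = z1])
      show "1 - D * t\<^sup>2 \<noteq> 0" "\<rho> \<noteq> 0" using w \<rho> by auto
      show "(z1 has_real_derivative - ((1 - t\<^sup>2) / (\<rho> * (1 - D * t\<^sup>2)\<^sup>2)) * z t) (at t)"
        unfolding \<rho>_def by (rule z1[OF t(1) t'(2)])
    qed (rule comparison_derivs[OF t'] z[OF t(1) t'(2)])+
    have "f t \<le> 1 * ((z t)\<^sup>2 / (1 - D * t\<^sup>2))"
      unfolding f_def \<nu>_def
    proof (rule mult_right_mono)
      show "0 \<le> (z t)\<^sup>2 / (1 - D * t\<^sup>2)" using w by simp
    qed (rule comparison_inequality, use D \<rho> \<kappa> t t' in simp_all)
    then show "f t \<le> (z t)\<^sup>2 / (1 - D * t\<^sup>2)" by simp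
  next
    have "continuous_on {0..T} z"
    proof (rule DERIV_continuous_on)
      fix t assume "t \<in> {0..T}"
      then have "(z has_real_derivative z1 t) (at t)" using T by (intro z) auto
      then show "(z has_real_derivative z1 t) (at t within {0..T})"
        by (rule has_field_derivative_at_within)
    qed
    then show "continuous_on {0..T} (\<lambda>t. (z t)\<^sup>2 / (1 - D * t\<^sup>2))"
      using W T by (intro continuous_intros) (auto simp: less_le)
  qed (use T in auto)
  moreover have "0 \<le> F T"
    using energy_form_nonneg[OF \<rho>(1) D T bd(1-4)] unfolding F_def by simp
  moreover have "(1 - \<rho> / 2) * ((1 - \<rho>) * (pi / 2) - \<kappa>) / 2 * (z 0)\<^sup>2 \<le> - F 0"
  proof -
    define p where "p = (1 - \<rho>) * (pi / 2) - \<kappa> + \<nu>"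
    have "63/64 * (314/200) \<le> (1 - \<rho>) * (pi / 2)"
      using \<rho> pi_approx by (intro mult_mono) auto
    then have p: "0 \<le> p" using \<kappa> \<nu> by (simp add: p_def)
    have "F 0 = - (p / 2 + \<rho> / 4 * (p + 6 * \<nu> - 2 * D * p)) * (z 0)\<^sup>2"
      unfolding F_def energy_form_def comparison_def comparison2_def angle_ratio_at_zero \<open>z1 0 = 0\<close> p_def
      by (simp add: algebra_simps)
    moreover have "(1 - \<rho> / 2) * p / 2 \<le> p / 2 + \<rho> / 4 * (p + 6 * \<nu> - 2 * D * p)"
    proof -
      have "D * p \<le> 1 * p" using D p by (intro mult_right_mono) auto
      then have "- p \<le> p + 6 * \<nu> - 2 * D * p" using \<nu> by simp
      then have "\<rho> / 4 * (- p) \<le> \<rho> / 4 * (p + 6 * \<nu> - 2 * D * p)"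
        using \<rho> by (intro mult_left_mono) auto
      moreover have "(1 - \<rho> / 2) * p / 2 = p / 2 + \<rho> / 4 * (- p)" by (simp add: field_simps)
      ultimately show ?thesis by simp
    qed
    moreover have "(1 - \<rho> / 2) * ((1 - \<rho>) * (pi / 2) - \<kappa>) / 2 \<le> (1 - \<rho> / 2) * p / 2"
      using \<rho> \<nu> unfolding p_def by (intro divide_right_mono mult_left_mono) auto
    ultimately show ?thesis
      by (simp only: minus_mult_left[symmetric] minus_minus)
         (intro mult_right_mono, auto)
  qed
  ultimately show ?thesis by (simp add: \<rho>_def \<kappa>_def)
qed

text \<open>
  The weight is the one that removes the first-order term of the differential equation.
\<close>

lemma weighted_ultraspherical_equation:
  fixes p p1 p2 :: "real \<Rightarrow> real" and \<alpha> :: real and k :: nat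
  defines "y \<equiv> \<lambda>x. (1 - x\<^sup>2) powr ((\<alpha> + 1) / 2) * p x"
    and "y1 \<equiv> \<lambda>x. (1 - x\<^sup>2) powr ((\<alpha> + 1) / 2) * (p1 x - (\<alpha> + 1) * x * p x / (1 - x\<^sup>2))"
  assumes p: "\<And>x. (p has_real_derivative p1 x) (at x)" "\<And>x. (p1 has_real_derivative p2 x) (at x)"
    and ode: "\<And>x. (1 - x\<^sup>2) * p2 x - 2 * (\<alpha> + 1) * x * p1 x + real k * (real k + 2 * \<alpha> + 1) * p x = 0"
    and x: "-1 < x" "x < 1"
  shows "(y has_real_derivative y1 x) (at x)"
    and "(y1 has_real_derivative - ((param_u k \<alpha> * (1 - x\<^sup>2) - (\<alpha>\<^sup>2 - 1)) / (1 - x\<^sup>2)\<^sup>2) * y x) (at x)"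
proof -
  define v where "v = (\<lambda>x::real. 1 - x\<^sup>2)"
  define E where "E = (\<lambda>x. v x powr ((\<alpha> + 1) / 2))"
  have v: "v x > 0" using abs_less_one_square[OF x] by (simp add: v_def)
  have dv: "(v has_real_derivative - 2 * x) (at x)"
    unfolding v_def by (auto intro!: derivative_eq_intros)
  have dE: "(E has_real_derivative - ((\<alpha> + 1) * x / v x) * E x) (at x)"
  proof -
    have "(E has_real_derivative (\<alpha> + 1) / 2 * v x powr ((\<alpha> + 1) / 2 - 1) * (- 2 * x)) (at x)"
      unfolding E_def using has_real_derivative_powr[OF v, of "(\<alpha> + 1) / 2"] dv
      by (rule DERIV_chain2)
    moreover have "v x powr ((\<alpha> + 1) / 2 - 1) = E x / v x"
      unfolding E_def using v by (subst powr_diff) simp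
    ultimately show ?thesis by (simp add: mult_ac)
  qed
  have y: "y = (\<lambda>x. E x * p x)" "y1 = (\<lambda>x. E x * (p1 x - (\<alpha> + 1) * x * p x / v x))"
    unfolding y_def y1_def E_def v_def by auto
  show "(y has_real_derivative y1 x) (at x)"
    unfolding y by (rule DERIV_cong[OF DERIV_mult[OF dE p(1)]]) (simp add: algebra_simps)
  define b where "b = \<alpha> + 1"
  have "(y1 has_real_derivative
      (- (b * x / v x) * E x) * (p1 x - b * x * p x / v x)
      + (p2 x - ((b * p x + p1 x * (b * x)) * v x - b * x * p x * (- 2 * x)) / (v x * v x)) * E x) (at x)"
    unfolding y b_def[symmetric] using dE v unfolding b_def[symmetric]
    by (intro DERIV_mult DERIV_diff DERIV_divide p dv)
       (auto intro!: derivative_eq_intros p)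
  moreover have "p2 x = (2 * b * x * p1 x - real k * (real k + 2 * \<alpha> + 1) * p x) / v x"
    using ode[of x] v by (simp add: v_def b_def field_simps)
  moreover have "(- (b * x / v x) * E x) * (p1 x - b * x * p x / v x)
      + ((2 * b * x * p1 x - c * p x) / v x
         - ((b * p x + p1 x * (b * x)) * v x - b * x * p x * (- 2 * x)) / (v x * v x)) * E x
      = - ((c * v x - b\<^sup>2 * x\<^sup>2 + b * v x + 2 * b * x\<^sup>2) / (v x)\<^sup>2) * (E x * p x)" for c
    using v by (simp add: field_simps power2_eq_square)
  moreover have "real k * (real k + 2 * \<alpha> + 1) * v x - b\<^sup>2 * x\<^sup>2 + b * v x + 2 * b * x\<^sup>2
      = param_u k \<alpha> * v x - (\<alpha>\<^sup>2 - 1)"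
    unfolding v_def b_def param_u_def by (simp add: power2_eq_square algebra_simps)
  ultimately show "(y1 has_real_derivative - ((param_u k \<alpha> * (1 - x\<^sup>2) - (\<alpha>\<^sup>2 - 1)) / (1 - x\<^sup>2)\<^sup>2) * y x) (at x)"
    unfolding y by (simp add: v_def)
qed

lemma integral_even_symmetric_interval:
  fixes f :: "real \<Rightarrow> real"
  assumes even: "\<And>x. f (- x) = f x" and int: "f integrable_on {- a..a}" and a: "0 \<le> a"
  shows "integral {- a..a} f = 2 * integral {0..a} f"
proof -
  have "integral {- a..0} f + integral {0..a} f = integral {- a..a} f"
    using a int by (intro Henstock_Kurzweil_Integration.integral_combine) auto
  moreover have "integral {- a..0} f = integral {0..a} f"
    using Henstock_Kurzweil_Integration.integral_reflect_real[of a 0 f] even by simp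
  ultimately show ?thesis by simp
qed

lemma integral_scale_interval:
  fixes f :: "real \<Rightarrow> real"
  assumes c: "c > 0" and int: "f integrable_on {0..c * b}" and b: "0 \<le> b"
  shows "integral {0..c * b} f = c * integral {0..b} (\<lambda>t. f (c * t))"
proof -
  have "((\<lambda>t. f (c * t)) has_integral (1 / \<bar>c\<bar>) *\<^sub>R integral {0..c * b} f) ((\<lambda>x. x / c) ` {0..c * b})"
    using integrable_integral[OF int] c by (intro has_integral_stretch_real) auto
  moreover have "(\<lambda>x. x / c) ` {0..c * b} = {0..b}"
    using c b by (simp add: image_divide_atLeastAtMost)
  ultimately have "integral {0..b} (\<lambda>t. f (c * t)) = (1 / c) * integral {0..c * b} f"
    using c by (simp add: integral_unique)
  then show ?thesis using c by simp
qed

text \<open>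
  The left-hand constant \<open>5/3\<close> exceeds \<open>2 / pi * 49/20 < 1.56\<close> by more than a tenth; the powers of \<open>r\<close>
  cost at most \<open>r / 24 + 3 / 64 * r\<close>.
\<close>

lemma final_numeric_inequality:
  fixes r :: real
  assumes r: "0 < r" "r \<le> 1/2"
  shows "1 - 5/3 * r < (1 - r ^ 6 / 2) * ((1 - r ^ 6) * (pi / 2) - 49/20 * r) * (2 / pi * (1 - r ^ 3 / 6))"
proof -
  have r3: "0 < r ^ 3" "r ^ 3 \<le> r / 4"
  proof -
    have "r\<^sup>2 * r \<le> (1/2)\<^sup>2 * r" using r by (intro mult_right_mono power_mono) auto
    then show "r ^ 3 \<le> r / 4" by (simp add: power2_eq_square power3_eq_cube)
  qed (use r in simp)
  have r6: "0 < r ^ 6" "r ^ 6 \<le> r / 32"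
  proof -
    have "r ^ 5 * r \<le> (1/2) ^ 5 * r" using r by (intro mult_right_mono power_mono) auto
    then show "r ^ 6 \<le> r / 32" by (simp add: eval_nat_numeral)
  qed (use r in simp)
  have "2 / pi * (49/20 * r) \<le> 39/25 * r"
  proof -
    have "314159/100000 \<le> pi" using pi_approx by simp
    then show ?thesis using r by (simp add: field_simps)
  qed
  then have m: "1 - r ^ 6 - 39/25 * r \<le> 2 / pi * ((1 - r ^ 6) * (pi / 2) - 49/20 * r)"
    by (simp add: algebra_simps)
  define x where "x = 1 - r ^ 6 - 39/25 * r"
  have x: "0 \<le> x" "x \<le> 1" using r6 r unfolding x_def by linarith+
  have prod: "1 - r ^ 6 / 2 - r ^ 3 / 6 \<le> (1 - r ^ 6 / 2) * (1 - r ^ 3 / 6)"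
  proof -
    have "1 - a / 2 - b / 6 \<le> (1 - a / 2) * (1 - b / 6)" if "0 \<le> a" "0 \<le> b" for a b :: real
      using mult_nonneg_nonneg[OF that] by (simp add: field_simps)
    then show ?thesis using r3 r6 by (meson less_imp_le)
  qed
  have nn: "0 \<le> (1 - r ^ 6 / 2) * (1 - r ^ 3 / 6)"
    using r3 r6 r by (intro mult_nonneg_nonneg) auto
  have "1 - 5/3 * r < x - (r ^ 6 / 2 + r ^ 3 / 6)"
    using r3 r6 r unfolding x_def by simp
  also have "\<dots> \<le> x - (r ^ 6 / 2 + r ^ 3 / 6) * x"
  proof -
    have "x - c \<le> x - c * x" if "0 \<le> c" for c
      using mult_left_mono[OF x(2) that] by simp
    moreover have "0 \<le> r ^ 6 / 2 + r ^ 3 / 6" using r3 r6 by linarith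
    ultimately show ?thesis by blast
  qed
  also have "\<dots> = (1 - r ^ 6 / 2 - r ^ 3 / 6) * x" by (simp add: algebra_simps)
  also have "\<dots> \<le> (1 - r ^ 6 / 2) * (1 - r ^ 3 / 6) * x" using prod x by (intro mult_right_mono) auto
  also have "\<dots> \<le> (1 - r ^ 6 / 2) * (1 - r ^ 3 / 6) * (2 / pi * ((1 - r ^ 6) * (pi / 2) - 49/20 * r))"
    using m nn unfolding x_def by (intro mult_left_mono) auto
  finally show ?thesis by (simp only: mult_ac)
qed

text \<open>
  Here \<open>s = k + \<alpha>\<close>, \<open>M = u * (1 - q)\<close>, and \<open>T\<close> is the product under the root in the lower bound for the
  central value.  The two are close: \<open>T / M \<le> 1 + r ^ 3 / 3\<close>, because \<open>s / M \<le> sqrt u / M = r ^ 3\<close>.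
\<close>

lemma scaled_central_value_bound:
  fixes s M T u r :: real
  assumes s: "0 < s" and u: "u = s * (s + 1)" and M: "0 < M" and T: "0 < T" "T \<le> M + s / 3"
    and r: "r ^ 3 = sqrt u / M" "0 < r" "r \<le> 1/2"
  shows "2 / pi * (1 - r ^ 3 / 6) \<le> sqrt (M / u) * ((2 * s + 1) / (pi * sqrt T))"
proof -
  have upos: "0 < u" using s u by simp
  define x where "x = r ^ 3 / 3"
  have r3: "r ^ 3 \<le> 1" using r by (intro power_le_one) auto
  have x: "0 \<le> x" "x \<le> 1/3" using zero_less_power[OF r(2), of 3] r3 unfolding x_def by linarith+
  have "s \<le> sqrt u" using s u by (intro real_le_rsqrt) (simp add: power2_eq_square)
  then have "s / 3 \<le> x * M" using M r(1) by (simp add: x_def field_simps)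
  then have TM: "T \<le> (1 + x) * M" using T by (simp add: algebra_simps)
  have "(1 - x / 2)\<^sup>2 * T \<le> (1 - x / 2)\<^sup>2 * ((1 + x) * M)" using TM by (intro mult_left_mono) auto
  also have "\<dots> = (1 - x\<^sup>2 * (3 - x) / 4) * M" by (simp add: power2_eq_square field_simps)
  also have "\<dots> \<le> 1 * M" using x M by (intro mult_right_mono) auto
  finally have "(1 - x / 2)\<^sup>2 \<le> M / T" using T by (simp add: pos_le_divide_eq)
  then have a: "1 - x / 2 \<le> sqrt (M / T)" by (rule real_le_rsqrt)
  have "sqrt u \<le> s + 1/2" using s u by (intro real_le_lsqrt) (auto simp: power2_eq_square algebra_simps)
  then have b: "2 \<le> (2 * s + 1) / sqrt u" using upos by (simp add: pos_le_divide_eq)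
  have "2 * (1 - x / 2) \<le> (2 * s + 1) / sqrt u * sqrt (M / T)"
    using a b x s upos by (intro mult_mono) auto
  also have "\<dots> = sqrt (M / u) * ((2 * s + 1) / sqrt T)" by (simp add: real_sqrt_divide)
  finally have "2 * (1 - x / 2) / pi \<le> sqrt (M / u) * ((2 * s + 1) / sqrt T) / pi"
    by (intro divide_right_mono) auto
  then show ?thesis by (simp add: x_def mult.commute)
qed

text \<open>
  Substituting \<open>x = sqrt D * t\<close> moves the turning point to \<open>t = 1\<close> and turns \<open>D * Q\<close> into
  \<open>(1 - t\<^sup>2) / (r ^ 6 * (1 - D * t\<^sup>2)\<^sup>2)\<close>.
\<close>

lemma ultraspherical_integral_ge:
  fixes \<alpha> r D :: real and k :: nat
  assumes k: "even k" and u: "0 < param_u k \<alpha>" and r: "0 < r" "r \<le> 1/2"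
    and D: "D = 1 - param_q k \<alpha>" "0 < D" "D \<le> 1" and r6: "r ^ 6 = 1 / (param_u k \<alpha> * D\<^sup>2)"
  defines "T \<equiv> cos (48/25 * r)"
  shows "(1 - r ^ 6 / 2) * ((1 - r ^ 6) * (pi / 2) - 49/20 * r)
           * (sqrt D * (orthonormal_ultraspherical k \<alpha> 0)\<^sup>2)
     \<le> 2 * integral {0..sqrt D * T} (\<lambda>x. (1 - x\<^sup>2) powr \<alpha> * (orthonormal_ultraspherical k \<alpha> x)\<^sup>2)"
proof -
  define \<delta> where "\<delta> = sqrt D"
  have \<delta>: "0 < \<delta>" "\<delta> \<le> 1" "\<delta>\<^sup>2 = D" using D by (auto simp: \<delta>_def)
  define c where "c = 1 / sqrt (ultraspherical_norm_sq k \<alpha>)"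
  define p where "p = orthonormal_ultraspherical k \<alpha>"
  have p_eq: "p = (\<lambda>x. c * jacobi_P k \<alpha> \<alpha> x)"
    by (simp add: p_def c_def fun_eq_iff orthonormal_ultraspherical_def)
  obtain P' P'' where P: "\<And>x. (jacobi_P k \<alpha> \<alpha> has_real_derivative P' x) (at x)"
      "\<And>x. (P' has_real_derivative P'' x) (at x)"
      "\<And>x. (1 - x\<^sup>2) * P'' x - 2 * (\<alpha> + 1) * x * P' x
            + real k * (real k + 2 * \<alpha> + 1) * jacobi_P k \<alpha> \<alpha> x = 0"
    using jacobi_P_differential_equation[of k \<alpha>] by blast
  define p1 where "p1 = (\<lambda>x. c * P' x)"
  define p2 where "p2 = (\<lambda>x. c * P'' x)"
  have p: "(p has_real_derivative p1 x) (at x)" "(p1 has_real_derivative p2 x) (at x)" for x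
    unfolding p_eq p1_def p2_def by (intro DERIV_cmult P)+
  have ode: "(1 - x\<^sup>2) * p2 x - 2 * (\<alpha> + 1) * x * p1 x + real k * (real k + 2 * \<alpha> + 1) * p x = 0" for x
  proof -
    have "(1 - x\<^sup>2) * p2 x - 2 * (\<alpha> + 1) * x * p1 x + real k * (real k + 2 * \<alpha> + 1) * p x
      = c * ((1 - x\<^sup>2) * P'' x - 2 * (\<alpha> + 1) * x * P' x
            + real k * (real k + 2 * \<alpha> + 1) * jacobi_P k \<alpha> \<alpha> x)"
      unfolding p_eq p1_def p2_def by (simp add: algebra_simps)
    then show ?thesis unfolding P(3) by simp
  qed
  have p_even: "p (- x) = p x" for x unfolding p_eq using jacobi_P_even[OF k] by simp
  have p10: "p1 0 = 0"
  proof -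
    have "((\<lambda>x. p (- x)) has_real_derivative - p1 0) (at 0)"
      using DERIV_mirror[of p "p1 0" 0] p(1)[of 0] by simp
    then have "(p has_real_derivative - p1 0) (at 0)" unfolding p_even .
    then have "- p1 0 = p1 0" using p(1)[of 0] by (rule DERIV_unique)
    then show ?thesis by simp
  qed
  define y where "y = (\<lambda>x. (1 - x\<^sup>2) powr ((\<alpha> + 1) / 2) * p x)"
  define y1 where "y1 = (\<lambda>x. (1 - x\<^sup>2) powr ((\<alpha> + 1) / 2) * (p1 x - (\<alpha> + 1) * x * p x / (1 - x\<^sup>2)))"
  have y_deriv: "(y has_real_derivative y1 x) (at x)" if "-1 < x" "x < 1" for x
    using weighted_ultraspherical_equation(1)[OF p ode that] unfolding y_def y1_def .
  have y1_deriv: "(y1 has_real_derivative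
      - ((param_u k \<alpha> * (1 - x\<^sup>2) - (\<alpha>\<^sup>2 - 1)) / (1 - x\<^sup>2)\<^sup>2) * y x) (at x)"
    if "-1 < x" "x < 1" for x
    using weighted_ultraspherical_equation(2)[OF p ode that] unfolding y_def y1_def .
  define z where "z = (\<lambda>t. y (\<delta> * t))"
  define z1 where "z1 = (\<lambda>t. \<delta> * y1 (\<delta> * t))"
  have dt: "-1 < \<delta> * t" "\<delta> * t < 1" if "0 \<le> t" "t < 1" for t
  proof -
    have "\<delta> * t \<le> 1 * t" using \<delta> that by (intro mult_right_mono) auto
    moreover have "0 \<le> \<delta> * t" using \<delta> that by simp
    ultimately show "-1 < \<delta> * t" "\<delta> * t < 1" using that by linarith+
  qed
  have chain: "((\<lambda>t. \<delta> * t) has_real_derivative \<delta>) (at t)" for t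
    using DERIV_cmult_Id[of \<delta> t] .
  have z: "(z has_real_derivative z1 t) (at t)" if "0 \<le> t" "t < 1" for t
    using DERIV_chain2[OF y_deriv[OF dt[OF that]] chain] unfolding z_def z1_def
    by (simp add: mult.commute)
  have z1: "(z1 has_real_derivative - ((1 - t\<^sup>2) / (r ^ 6 * (1 - D * t\<^sup>2)\<^sup>2)) * z t) (at t)"
    if "0 \<le> t" "t < 1" for t
  proof -
    let ?Q = "(param_u k \<alpha> * (1 - (\<delta> * t)\<^sup>2) - (\<alpha>\<^sup>2 - 1)) / (1 - (\<delta> * t)\<^sup>2)\<^sup>2"
    have E1: "(z1 has_real_derivative \<delta> * ((- ?Q * y (\<delta> * t)) * \<delta>)) (at t)"
      unfolding z1_def by (rule DERIV_cmult[OF DERIV_chain2[OF y1_deriv[OF dt[OF that]] chain]])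
    have E2: "\<delta> * ((- ?Q * y (\<delta> * t)) * \<delta>) = - (D * ?Q) * z t"
      unfolding z_def \<delta>(3)[symmetric] by (simp add: power2_eq_square)
    have E3: "D * ?Q = (1 - t\<^sup>2) / (r ^ 6 * (1 - D * t\<^sup>2)\<^sup>2)"
    proof -
      have "param_u k \<alpha> * (1 - D * t\<^sup>2) - (\<alpha>\<^sup>2 - 1) = param_u k \<alpha> * D * (1 - t\<^sup>2)"
      proof -
        have "\<alpha>\<^sup>2 - 1 = param_u k \<alpha> * (1 - D)" using u by (simp add: D(1) param_q_def)
        then show ?thesis by (simp add: algebra_simps)
      qed
      then have "D * ?Q = (param_u k \<alpha> * D\<^sup>2) * (1 - t\<^sup>2) / (1 - D * t\<^sup>2)\<^sup>2"
        unfolding power_mult_distrib \<delta>(3) by (simp add: power2_eq_square)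
      also have "param_u k \<alpha> * D\<^sup>2 = 1 / r ^ 6" unfolding r6 by simp
      finally show ?thesis by simp
    qed
    show ?thesis using E1 unfolding E2 E3 .
  qed
  have z10: "z1 0 = 0" by (simp add: z1_def y1_def p10)
  have z0: "(z 0)\<^sup>2 = (p 0)\<^sup>2" by (simp add: z_def y_def)
  define f where "f = (\<lambda>x. (1 - x\<^sup>2) powr \<alpha> * (p x)\<^sup>2)"
  have fy: "f x = (y x)\<^sup>2 / (1 - x\<^sup>2)" if "-1 < x" "x < 1" for x
  proof -
    have v: "0 < 1 - x\<^sup>2" using abs_less_one_square that by simp
    have "((1 - x\<^sup>2) powr ((\<alpha> + 1) / 2))\<^sup>2 = (1 - x\<^sup>2) powr (\<alpha> + 1)"
      using v by (simp add: power2_eq_square flip: powr_add)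
    also have "\<dots> = (1 - x\<^sup>2) powr \<alpha> * (1 - x\<^sup>2)" using v by (simp add: powr_add)
    finally show ?thesis using v unfolding f_def y_def by (simp add: power_mult_distrib)
  qed
  have T: "0 \<le> T" "T < 1" using comparison_boundary(5,6)[OF r] by (auto simp: T_def)
  have "continuous_on {0..\<delta> * T} f"
  proof (rule continuous_at_imp_continuous_on, intro ballI)
    fix x assume x: "x \<in> {0..\<delta> * T}"
    then have "-1 < x" "x < 1" using dt[OF T] by auto
    then have "0 < 1 - x\<^sup>2" by (rule abs_less_one_square)
    moreover have "isCont p x" using p(1) by (rule DERIV_isCont)
    ultimately show "isCont f x" unfolding f_def by (intro continuous_intros) auto
  qed
  then have "f integrable_on {0..\<delta> * T}" by (rule integrable_continuous_interval)
  then have "integral {0..\<delta> * T} f = \<delta> * integral {0..T} (\<lambda>t. f (\<delta> * t))"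
    using \<delta> T by (intro integral_scale_interval) auto
  also have "integral {0..T} (\<lambda>t. f (\<delta> * t)) = integral {0..T} (\<lambda>t. (z t)\<^sup>2 / (1 - D * t\<^sup>2))"
  proof (rule integral_cong)
    fix t assume "t \<in> {0..T}"
    then have "0 \<le> t" "t < 1" using T by auto
    then show "f (\<delta> * t) = (z t)\<^sup>2 / (1 - D * t\<^sup>2)"
      using fy[OF dt] by (simp add: z_def power_mult_distrib \<delta>(3))
  qed
  finally have I: "integral {0..\<delta> * T} f = \<delta> * integral {0..T} (\<lambda>t. (z t)\<^sup>2 / (1 - D * t\<^sup>2))" .
  have "(1 - r ^ 6 / 2) * ((1 - r ^ 6) * (pi / 2) - 49/20 * r) / 2 * (z 0)\<^sup>2
     \<le> integral {0..T} (\<lambda>t. (z t)\<^sup>2 / (1 - D * t\<^sup>2))"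
    unfolding T_def using oscillation_integral_ge[OF r _ D(3) z z1 z10] D by simp
  then have "\<delta> * ((1 - r ^ 6 / 2) * ((1 - r ^ 6) * (pi / 2) - 49/20 * r) / 2 * (p 0)\<^sup>2)
     \<le> integral {0..\<delta> * T} f"
    unfolding I z0 using \<delta> by (intro mult_left_mono) auto
  then show ?thesis unfolding f_def p_def \<delta>_def by (simp add: mult_ac)
qed

section \<open>The cutoff and the final estimate\<close>

theorem theorem2:
  fixes k :: nat and \<alpha> :: real
  assumes "k \<ge> 10" and "even k"
    and "\<alpha> \<ge> 3 - real k / 2" and "\<bar>\<alpha>\<bar> \<ge> 1"
  shows "integral {- cutoff_eta k \<alpha> .. cutoff_eta k \<alpha>}
           (\<lambda>x. (1 - x\<^sup>2) powr \<alpha> * (orthonormal_ultraspherical k \<alpha> x)\<^sup>2)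
         > 1 - 5 / (3 * (1 - param_q k \<alpha>) powr (1/3) * param_u k \<alpha> powr (1/6))
       \<and> 1 - 5 / (3 * (1 - param_q k \<alpha>) powr (1/3) * param_u k \<alpha> powr (1/6))
         > 1 - 5 / 3 * ((real k + \<alpha>) / ((real k + 2 * \<alpha>) * real k)) powr (1/3)"
proof -
  define s where "s = real k + \<alpha>"
  define N where "N = (real k + 2 * \<alpha>) * real k"
  define u where "u = param_u k \<alpha>"
  define D where "D = 1 - param_q k \<alpha>"
  define M where "M = N + s + 1"
  define r where "r = D powr (- 1/3) * u powr (- 1/6)"
  have k10: "10 \<le> real k" and nu6: "6 \<le> real k + 2 * \<alpha>" using assms(1,3) by auto
  have s: "0 < s" "2 * s = real k + (real k + 2 * \<alpha>)" using k10 nu6 by (auto simp: s_def)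
  have N: "0 < N" unfolding N_def using k10 nu6 by simp
  have M: "0 < M" using N s by (simp add: M_def)
  have u: "u = s * (s + 1)" "0 < u" using s(1) by (auto simp: u_def s_def param_u_def)
  have uD: "u * D = M"
  proof -
    have "u * param_q k \<alpha> = \<alpha>\<^sup>2 - 1" using u(2) by (simp add: param_q_def u_def)
    then have "u * D = u - (\<alpha>\<^sup>2 - 1)" by (simp add: D_def right_diff_distrib)
    also have "\<dots> = M" unfolding u M_def N_def s_def by (simp add: power2_eq_square algebra_simps)
    finally show ?thesis .
  qed
  have D: "0 < D" "D \<le> 1"
  proof -
    show "0 < D" using uD M u(2) by (metis zero_less_mult_pos)
    have "1 \<le> \<alpha>\<^sup>2" using assms(4) by (metis abs_le_square_iff abs_1 power_one)
    then show "D \<le> 1" using u(2) by (simp add: D_def param_q_def u_def)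
  qed
  have r: "0 < r" using D u(2) by (simp add: r_def)
  \<comment> \<open>The powers of \<open>r\<close> that occur in the cutoff, in the bound for \<open>r\<close>, and in the scaled equation.\<close>
  have r2: "r\<^sup>2 = 1 / (D powr (2/3) * u powr (1/3))"
    using D u(2) by (simp add: r_def power_mult_distrib powr_power powr_minus field_simps)
  have r3: "r ^ 3 = sqrt u / M"
  proof -
    have "r ^ 3 = D powr (- 1) * u powr (- (1/2))"
      using D u(2) by (simp add: r_def power_mult_distrib powr_power)
    also have "\<dots> = sqrt u / (u * D)"
      using D u(2) by (simp add: powr_minus powr_half_sqrt field_simps)
    finally show ?thesis unfolding uD .
  qed
  have r6: "r ^ 6 = 1 / (u * D\<^sup>2)"
  proof -
    have "r ^ 6 = (r ^ 3)\<^sup>2" by (simp flip: power_mult)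
    also have "\<dots> = u / (u * D)\<^sup>2" unfolding r3 uD using u(2) by (simp add: power_divide)
    finally show ?thesis using u(2) D by (simp add: power_mult_distrib power2_eq_square)
  qed
  have sqrt_u: "sqrt u \<le> s + 1/2"
    using s u by (intro real_le_lsqrt) (auto simp: power2_eq_square algebra_simps)
  have r_half: "r \<le> 1/2"
  proof -
    \<comment> \<open>With \<open>n = k + 2 * \<alpha>\<close>, the difference \<open>M - 8 * (s + 1/2)\<close> equals \<open>k * n - 7/2 * (k + n) - 3\<close>,
       and \<open>k \<ge> 10\<close>, \<open>n \<ge> 6\<close> give just enough after completing the product.\<close>
    have "(13/2) * (5/2) \<le> (real k - 7/2) * (real k + 2 * \<alpha> - 7/2)"
      using k10 nu6 by (intro mult_mono) auto
    moreover have "(real k - 7/2) * (real k + 2 * \<alpha> - 7/2) = M - 8 * (s + 1/2) + 61/4"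
      unfolding M_def N_def s_def by (simp add: field_simps)
    ultimately have "8 * (s + 1/2) \<le> M" by simp
    then have "8 * sqrt u \<le> M" using sqrt_u by simp
    then have "r ^ 3 \<le> (1/2) ^ 3" unfolding r3 using M by (simp add: field_simps power3_eq_cube)
    then show ?thesis using r by (intro power_le_imp_le_base[of r 2 "1/2"]) (auto simp: numeral_3_eq_3)
  qed
  have bound: "5 / (3 * D powr (1/3) * u powr (1/6)) = 5/3 * r"
    using D u(2) by (simp add: r_def powr_minus field_simps)
  have eta: "cutoff_eta k \<alpha> = sqrt D * (1 - 4 * 2 powr (1/3) / 3 * r\<^sup>2)"
    unfolding cutoff_eta_def D_def[symmetric] u_def[symmetric] r2 by simp
  define T where "T = cos (48/25 * r)"
  note bd = comparison_boundary(5-7)[OF r r_half, folded T_def]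
  have cbrt2: "2 powr (1/3) \<le> (126/100 :: real)"
  proof -
    have "2 powr (1/3) \<le> ((126/100) ^ 3 :: real) powr (1/3)"
      by (intro powr_mono2) (auto simp: power3_eq_cube)
    also have "\<dots> = 126/100" by (simp add: powr_powr flip: powr_numeral)
    finally show ?thesis .
  qed
  have eta_ge: "sqrt D * T \<le> cutoff_eta k \<alpha>"
  proof -
    have "4 * 2 powr (1/3) / 3 * r\<^sup>2 \<le> 42/25 * r\<^sup>2" using cbrt2 by (intro mult_right_mono) auto
    then have "T \<le> 1 - 4 * 2 powr (1/3) / 3 * r\<^sup>2" using bd(3) by linarith
    then show ?thesis unfolding eta using D by (intro mult_left_mono) auto
  qed
  have eta_lt: "cutoff_eta k \<alpha> < 1"
  proof -
    have "sqrt D * (1 - 4 * 2 powr (1/3) / 3 * r\<^sup>2) < sqrt D * 1"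
      using D r by (intro mult_strict_left_mono) auto
    also have "sqrt D * 1 \<le> 1" using D by simp
    finally show ?thesis unfolding eta .
  qed
  define f where "f = (\<lambda>x. (1 - x\<^sup>2) powr \<alpha> * (orthonormal_ultraspherical k \<alpha> x)\<^sup>2)"
  have T0: "0 \<le> sqrt D * T" using D bd by simp
  have f_cont: "continuous_on {- cutoff_eta k \<alpha>..cutoff_eta k \<alpha>} f"
  proof -
    have "1 - x\<^sup>2 \<noteq> 0" if "x \<in> {- cutoff_eta k \<alpha>..cutoff_eta k \<alpha>}" for x
      using abs_less_one_square[of x] that eta_lt by auto
    then show ?thesis
      unfolding f_def orthonormal_ultraspherical_def jacobi_P_def divide_inverse
      by (intro continuous_intros) auto
  qed
  then have f_int: "f integrable_on {- cutoff_eta k \<alpha>..cutoff_eta k \<alpha>}"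
    by (rule integrable_continuous_interval)
  have f_int': "f integrable_on {- (sqrt D * T)..sqrt D * T}"
    using eta_ge by (intro integrable_on_subinterval[OF f_int]) auto
  obtain m where m: "k = 2 * m" using assms(2) by blast
  have "2 / pi * (1 - r ^ 3 / 6) \<le> sqrt D * (orthonormal_ultraspherical k \<alpha> 0)\<^sup>2"
  proof -
    define R where "R = (real k + 2/3) * (real k + 2 * \<alpha> + 2/3)"
    have R: "0 < R" "R \<le> M + s / 3"
    proof -
      show "0 < R" unfolding R_def using k10 nu6 by (intro mult_pos_pos) auto
      have "R = N + 4/3 * s + 4/9" unfolding R_def N_def s_def by (simp add: field_simps)
      then show "R \<le> M + s / 3" unfolding M_def by simp
    qed
    have Dq: "D = M / u" using uD u(2) by (simp add: field_simps)
    have "2 / pi * (1 - r ^ 3 / 6) \<le> sqrt (M / u) * ((2 * s + 1) / (pi * sqrt R))"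
      by (rule scaled_central_value_bound[OF s(1) u(1) M R r3 r r_half])
    also have "(2 * s + 1) / (pi * sqrt R) \<le> (orthonormal_ultraspherical k \<alpha> 0)\<^sup>2"
      unfolding s_def R_def
      by (rule orthonormal_ultraspherical_at_zero_ge[OF m]) (use m k10 nu6 in auto)
    finally show ?thesis unfolding Dq using M u(2) by (simp add: mult_left_mono)
  qed
  then have "(1 - r ^ 6 / 2) * ((1 - r ^ 6) * (pi / 2) - 49/20 * r) * (2 / pi * (1 - r ^ 3 / 6))
      \<le> (1 - r ^ 6 / 2) * ((1 - r ^ 6) * (pi / 2) - 49/20 * r)
          * (sqrt D * (orthonormal_ultraspherical k \<alpha> 0)\<^sup>2)"
  proof (rule mult_left_mono)
    have "r ^ 6 \<le> (1/2) ^ 6" using r r_half by (intro power_mono) auto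
    then have q: "r ^ 6 \<le> 1/64" by (simp add: power_divide)
    have "63/64 * (314/200) \<le> (1 - r ^ 6) * (pi / 2)"
      using q pi_approx by (intro mult_mono) auto
    then show "0 \<le> (1 - r ^ 6 / 2) * ((1 - r ^ 6) * (pi / 2) - 49/20 * r)"
      using q r_half by (intro mult_nonneg_nonneg) auto
  qed
  then have "1 - 5/3 * r < (1 - r ^ 6 / 2) * ((1 - r ^ 6) * (pi / 2) - 49/20 * r)
          * (sqrt D * (orthonormal_ultraspherical k \<alpha> 0)\<^sup>2)"
    using final_numeric_inequality[OF r r_half] by simp
  also have "\<dots> \<le> 2 * integral {0..sqrt D * T} f"
    unfolding f_def T_def
    by (rule ultraspherical_integral_ge[OF assms(2) u(2)[unfolded u_def] r r_half D_def D])
       (use r6 in \<open>simp add: u_def\<close>)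
  also have "\<dots> = integral {- (sqrt D * T)..sqrt D * T} f"
    using f_int' T0 jacobi_P_even[OF assms(2)]
    by (intro integral_even_symmetric_interval[symmetric])
       (auto simp: f_def orthonormal_ultraspherical_def)
  also have "\<dots> \<le> integral {- cutoff_eta k \<alpha>..cutoff_eta k \<alpha>} f"
    using eta_ge f_int f_int' by (intro integral_subset_le) (auto simp: f_def)
  finally have first: "1 - 5/3 * r < integral {- cutoff_eta k \<alpha>..cutoff_eta k \<alpha>} f" .
  have second: "r < (s / N) powr (1/3)"
  proof -
    have "N \<le> s\<^sup>2"
      unfolding N_def s_def by (simp add: power2_eq_square algebra_simps)
    moreover have "s * M - N * (s + 1/2) = s\<^sup>2 + s - N / 2"
      unfolding M_def by (simp add: power2_eq_square field_simps)
    moreover have "0 < s\<^sup>2" using s(1) by simp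
    ultimately have "N * (s + 1/2) < s * M" using s(1) by linarith
    then have "N * sqrt u < s * M" using sqrt_u N by (smt (verit) mult_left_mono)
    then have "r ^ 3 < s / N" unfolding r3 using N M by (simp add: field_simps)
    then have "(r ^ 3) powr (1/3) < (s / N) powr (1/3)"
      using r by (intro powr_less_mono2) auto
    then show ?thesis using r by (simp add: powr_powr flip: powr_numeral)
  qed
  show ?thesis
    using first second unfolding D_def[symmetric] u_def[symmetric] bound f_def s_def N_def by simp
qed

end
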